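(* Let $\mathsf{h}:[n]\to[n]$ be a Hessenberg function and let $\mu$ be a partition of $n$. Then, for every prime power $q$, \[ \mathrm{F}_{\mu\mathsf{h}}(q)=q^{\binom{n}{2}-\mathsf{n}(\mu)-(n-\ell(\mu))}(q-1)^{n-\ell(\mu)}\,\underline{\mathrm{F}}_{\mu'\mathsf{h}}(1/q). \]
   Context: A Hessenberg function is a non-decreasing map $\mathsf{h}:[n]\to[n]$ with $\mathsf{h}(i)\ge i$. For a prime power $q$, $\mathfrak{u}_\mathsf{h}(\mathbb{F}_q)$ is the set of $n\times n$ matrices $(a_{ij})$ over $\mathbb{F}_q$ with $a_{ij}=0$ whenever $j\le\mathsf{h}(i)$; $J_\mu$ is the nilpotent Jordan matrix with (upper triangular) blocks of sizes $\mu_1,\mu_2,\dots$; $\mathcal{C}_\mu$ is its $\mathrm{GL}_n(\mathbb{F}_q)$-conjugacy class and $\mathrm{F}_{\mu\mathsf{h}}(q)=|\mathcal{C}_\mu\cap\mathfrak{u}_\mathsf{h}(\mathbb{F}_q)|$. $\ell(\mu)$ is the number of parts, $\mu'$ the conjugate partition, $\mathsf{n}(\mu)=\sum_i(i-1)\mu_i$. The partial order $\prec_\mathsf{h}$ on $[n]$: $i\prec_\mathsf{h} j$ iff $\mathsf{h}(i)<j$. For a partition $\nu$, $\mathrm{SYT}^\mathsf{h}_\nu$ is the set of standard Young tableaux $T$ of shape $\nu$ (English convention, entries $1,\dots,|\nu|$ increasing along rows and down columns) such that whenever $i$ is above $j$ in the same column, $i\prec_\mathsf{h} j$. For a box $b$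 of $T$: $T(b)$ is its entry; $\mathrm{coleg}(b)$ is the number of boxes strictly above $b$ in its column; if $\mathrm{coleg}(b)\ge1$, $\mathrm{up}(b)$ is the box directly above $b$; $\gamma(T,b)$ is the number of boxes $c$ lying in any row above the row of $b$ with $T(c)<T(b)$ and $T(c)\not\prec_\mathsf{h}T(b)$ (and $\gamma(T,b)=0$ if $\mathrm{coleg}(b)=0$); $\gamma(T)=\sum_{b:\,\mathrm{coleg}(b)\ge1}\gamma(T,b)$. For a box $d$ and integer $x$, $\mathrm{arm}_\mathsf{h}(d,x)$ is the number of boxes $c$ strictly to the right of $d$ in the same row with $T(c)\prec_\mathsf{h}x$. With $[m]_q=(q^m-1)/(q-1)$, define \[ \underline{\mathrm{F}}_{\nu\mathsf{h}}(q)=\sum_{T\in\mathrm{SYT}^\mathsf{h}_\nu}q^{\gamma(T)}\prod_{b\in T,\ \mathrm{coleg}(b)\ge1}[\mathrm{arm}_\mathsf{h}(\mathrm{up}(b),T(b))+1]_q . \] *)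

theory Defs
  imports
    "HOL-Library.FuncSet"
    "HOL-Library.Cardinality"
    "Jordan_Normal_Form.Jordan_Normal_Form"
begin

definition hessenberg :: "nat \<Rightarrow> (nat \<Rightarrow> nat) \<Rightarrow> bool" where
  "hessenberg n h \<longleftrightarrow>
     h \<in> {1..n} \<rightarrow> {1..n} \<and> mono_on {1..n} h \<and> (\<forall>i\<in>{1..n}. i \<le> h i)"

definition hprec :: "(nat \<Rightarrow> nat) \<Rightarrow> nat \<Rightarrow> nat \<Rightarrow> bool" where
  "hprec h i j \<longleftrightarrow> h i < j"


text \<open>Partitions are weakly decreasing lists of positive parts, so that \<open>length\<close> is the
  number of parts. List positions start at 0: the part written \<open>\<mu>\<^sub>i\<close> is \<open>\<mu> ! (i - 1)\<close>.\<close>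

definition is_partition :: "nat \<Rightarrow> nat list \<Rightarrow> bool" where
  "is_partition n \<mu> \<longleftrightarrow> sorted_wrt (\<ge>) \<mu> \<and> (\<forall>m\<in>set \<mu>. 0 < m) \<and> sum_list \<mu> = n"

definition conj_part :: "nat list \<Rightarrow> nat list" where
  "conj_part \<mu> =
     map (\<lambda>j. card {i. i < length \<mu> \<and> j < \<mu> ! i}) [0..<(case \<mu> of [] \<Rightarrow> 0 | m # _ \<Rightarrow> m)]"

definition n_stat :: "nat list \<Rightarrow> nat" where
  "n_stat \<mu> = (\<Sum>i<length \<mu>. i * \<mu> ! i)"


text \<open>Matrix positions in \<open>$$\<close> start at 0, whereas \<open>h\<close> acts on \<open>{1..n}\<close>.\<close>

definition ad_nilp_ideal :: "nat \<Rightarrow> (nat \<Rightarrow> nat) \<Rightarrow> 'a::field mat set" where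
  "ad_nilp_ideal n h =
     {A \<in> carrier_mat n n. \<forall>i\<in>{1..n}. \<forall>j\<in>{1..n}. j \<le> h i \<longrightarrow> A $$ (i - 1, j - 1) = 0}"

definition nilp_jordan :: "nat list \<Rightarrow> 'a::field mat" where
  "nilp_jordan \<mu> = jordan_matrix (map (\<lambda>m. (m, 0)) \<mu>)"

definition nilp_class :: "nat list \<Rightarrow> 'a::field mat set" where
  "nilp_class \<mu> = {A. similar_mat A (nilp_jordan \<mu>)}"

text \<open>The field with \<open>q\<close> elements is given by a type, which is passed as the first argument.\<close>

definition F_count :: "'a::{field,finite} itself \<Rightarrow> nat \<Rightarrow> nat list \<Rightarrow> (nat \<Rightarrow> nat) \<Rightarrow> nat" where
  "F_count _ n \<mu> h = card (nilp_class \<mu> \<inter> ad_nilp_ideal n h :: 'a mat set)"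


text \<open>A box is a pair (row, column), both starting at 0, with row 0 at the top. Tableaux are
  extensional functions on the boxes, so that each tableau is represented exactly once.\<close>

type_synonym box = "nat \<times> nat"

definition boxes :: "nat list \<Rightarrow> box set" where
  "boxes \<nu> = {(r, c). r < length \<nu> \<and> c < \<nu> ! r}"

definition SYT :: "nat list \<Rightarrow> (box \<Rightarrow> nat) set" where
  "SYT \<nu> = {T \<in> extensional (boxes \<nu>).
     bij_betw T (boxes \<nu>) {1..sum_list \<nu>} \<and>
     (\<forall>a\<in>boxes \<nu>. \<forall>b\<in>boxes \<nu>.
        (fst a = fst b \<and> snd a < snd b \<longrightarrow> T a < T b) \<and>
        (snd a = snd b \<and> fst a < fst b \<longrightarrow> T a < T b))}"

definition SYT_h :: "(nat \<Rightarrow> nat) \<Rightarrow> nat list \<Rightarrow> (box \<Rightarrow> nat) set" where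
  "SYT_h h \<nu> = {T \<in> SYT \<nu>.
     \<forall>a\<in>boxes \<nu>. \<forall>b\<in>boxes \<nu>. snd a = snd b \<and> fst a < fst b \<longrightarrow> hprec h (T a) (T b)}"

definition coleg :: "nat list \<Rightarrow> box \<Rightarrow> nat" where
  "coleg \<nu> b = card {c \<in> boxes \<nu>. snd c = snd b \<and> fst c < fst b}"

definition up :: "box \<Rightarrow> box" where
  "up b = (fst b - 1, snd b)"

definition gamma_box :: "(nat \<Rightarrow> nat) \<Rightarrow> nat list \<Rightarrow> (box \<Rightarrow> nat) \<Rightarrow> box \<Rightarrow> nat" where
  "gamma_box h \<nu> T b =
     (if coleg \<nu> b = 0 then 0
      else card {c \<in> boxes \<nu>. fst c < fst b \<and> T c < T b \<and> \<not> hprec h (T c) (T b)})"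

definition gamma :: "(nat \<Rightarrow> nat) \<Rightarrow> nat list \<Rightarrow> (box \<Rightarrow> nat) \<Rightarrow> nat" where
  "gamma h \<nu> T = (\<Sum>b\<in>{b \<in> boxes \<nu>. 1 \<le> coleg \<nu> b}. gamma_box h \<nu> T b)"

definition arm_h :: "(nat \<Rightarrow> nat) \<Rightarrow> nat list \<Rightarrow> (box \<Rightarrow> nat) \<Rightarrow> box \<Rightarrow> nat \<Rightarrow> nat" where
  "arm_h h \<nu> T d x =
     card {c \<in> boxes \<nu>. fst c = fst d \<and> snd d < snd c \<and> hprec h (T c) x}"

text \<open>Only meaningful for \<open>q \<noteq> 1\<close>, since division by zero yields \<open>0\<close>; so is
  \<open>F_under\<close>, which is needed only at \<open>1 / q\<close> with \<open>q \<ge> 2\<close>.\<close>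

definition q_int :: "'b::field \<Rightarrow> nat \<Rightarrow> 'b" where
  "q_int q m = (q ^ m - 1) / (q - 1)"

definition F_under :: "nat list \<Rightarrow> (nat \<Rightarrow> nat) \<Rightarrow> 'b::field \<Rightarrow> 'b" where
  "F_under \<nu> h q =
     (\<Sum>T\<in>SYT_h h \<nu>. q ^ gamma h \<nu> T *
        (\<Prod>b\<in>{b \<in> boxes \<nu>. 1 \<le> coleg \<nu> b}. q_int q (arm_h h \<nu> T (up b) (T b) + 1)))"

end

theory Submission
  imports
    Defs
    "HOL-Library.Function_Algebras"
    "HOL-Library.Product_Plus"
    "Jordan_Normal_Form.Jordan_Normal_Form_Existence"
    "Jordan_Normal_Form.Jordan_Normal_Form_Uniqueness"
begin

text \<open>The leading principal submatrices of a matrix $A$ in the ideal form a chain of restrictions of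
  $A$ to the coordinate subspaces $V_0 \subset V_1 \subset \dots \subset V_n$. Recording the
  Jordan types along this chain gives, after conjugation, a growing sequence of Young diagrams, i.e.
  a standard tableau of shape $\mu'$. The column $v$ added in step $m$ ranges over
  $V_k$, where $k$ counts the $i$ with $i \prec m$, and $V_k$ contains the image
  $A V_m$. The new box lands in one of the rows $0, \dots, s$ if and only if
  $v \in A V_m + (V_k \cap \ker A^s)$; the cardinality of this subspace is determined by the
  Jordan types of $A$ on $V_m$ and on $V_k$, because the restriction of $A$ to
  $V_m \cap \ker A^{s+1}$ has image $A V_m \cap \ker A^s$. So the number of matrices with a given
  tableau is a product of one factor per box. The factor of a box in row 0 is a power of $q$;
  for any other box it is non-zero exactly when the
  condition $\prec$ holds between it and the box above it, and then it is a power of $q$ times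
  $1 - q^{-(a+1)}$, where $a$ is the arm of the box above.\<close>

section \<open>Additive maps on finite groups\<close>

lemma card_field_gt_1: "1 < CARD('a::{field,finite})"
  using card_mono[of UNIV "{0::'a, 1}"] by simp

text \<open>All fibres over the image are translates of the fibre over 0; closure under differences
  together with \<open>0 \<in> S\<close> makes \<open>S\<close> a subgroup.\<close>

lemma card_additive_image:
  fixes f :: "'v::group_add \<Rightarrow> 'w::group_add"
  assumes fin: "finite S" and 0: "0 \<in> S" and diff: "\<And>x y. x \<in> S \<Longrightarrow> y \<in> S \<Longrightarrow> x - y \<in> S"
    and f: "\<And>x y. x \<in> S \<Longrightarrow> y \<in> S \<Longrightarrow> f (x - y) = f x - f y"
  shows "card S = card (f ` S) * card {x \<in> S. f x = 0}"
proof -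
  have add: "x + y \<in> S" if "x \<in> S" "y \<in> S" for x y
    using diff[OF that(1) diff[OF 0 that(2)]] by simp
  have fadd: "f (x + y) = f x + f y" if "x \<in> S" "y \<in> S" for x y
    using f[OF add[OF that] that(2)] by (simp add: algebra_simps)
  have "card {x \<in> S. f x = y} = card {x \<in> S. f x = 0}" if y: "y \<in> f ` S" for y
  proof -
    obtain z where z: "z \<in> S" "y = f z" using y by blast
    show ?thesis
    proof (rule bij_betw_same_card[of "\<lambda>x. x - z"], rule bij_betw_byWitness[of _ "\<lambda>x. x + z"])
    qed (use z f diff add fadd in auto)
  qed
  then have "(\<Sum>y\<in>f ` S. card {x \<in> S. f x = y}) = card (f ` S) * card {x \<in> S. f x = 0}" by simp
  moreover have "card S = (\<Sum>y\<in>f ` S. card {x \<in> S. f x = y})"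
    using sum.group[OF fin finite_imageI[OF fin] order_refl, where g = f and h = "\<lambda>_. 1::nat"] by simp
  ultimately show ?thesis by simp
qed

lemma additive_funpow:
  fixes f :: "'v::group_add \<Rightarrow> 'v"
  assumes "\<And>x y. f (x - y) = f x - f y"
  shows "(f ^^ r) (x - y) = (f ^^ r) x - (f ^^ r) y"
  by (induction r) (use assms in auto)

text \<open>The set counted is f V + (U \<inter> ker f^s), the image of the map (u, x) \<mapsto> f u
  + x on V \<times> (U \<inter> ker f^s). The kernel of this map is a copy of V \<inter> ker f^(s+1)
  through u \<mapsto> (u, - f u), so the identity is image times kernel.\<close>

lemma card_reachable:
  fixes f :: "'v::ab_group_add \<Rightarrow> 'v"
  assumes fin: "finite V" and 0: "0 \<in> U" and VU: "U \<subseteq> V"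
    and V: "\<And>x y. x \<in> V \<Longrightarrow> y \<in> V \<Longrightarrow> x - y \<in> V"
    and U: "\<And>x y. x \<in> U \<Longrightarrow> y \<in> U \<Longrightarrow> x - y \<in> U"
    and f: "\<And>x y. f (x - y) = f x - f y" and fV: "f ` V \<subseteq> U"
  shows "card {v \<in> U. \<exists>u\<in>V. (f ^^ Suc s) u = (f ^^ s) v} * card {x \<in> V. (f ^^ Suc s) x = 0} =
    card V * card {x \<in> U. (f ^^ s) x = 0}"
proof -
  define K where "K = {x \<in> U. (f ^^ s) x = 0}"
  define g where "g = (\<lambda>(u, x). f u + x)"
  note fs = additive_funpow[of f, OF f]
  have fs0: "(f ^^ r) 0 = 0" for r using fs[of r 0 0] by simp
  have fsm: "(f ^^ r) (- x) = - (f ^^ r) x" for r x using fs[of r 0 x] fs0 by simp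
  have fsp: "(f ^^ r) (x + y) = (f ^^ r) x + (f ^^ r) y" for r x y using fs[of r x "- y"] fsm by simp
  have Up: "x + y \<in> U" if "x \<in> U" "y \<in> U" for x y using U[OF that(1) U[OF 0 that(2)]] by simp
  have Um: "- x \<in> U" if "x \<in> U" for x using U[OF 0 that] by simp
  have fS: "(f ^^ s) (f u) = (f ^^ Suc s) u" for u by (simp add: funpow_swap1)
  have finU: "finite U" using fin VU finite_subset by blast
  have "card (V \<times> K) = card (g ` (V \<times> K)) * card {p \<in> V \<times> K. g p = 0}"
  proof (rule card_additive_image)
    show "finite (V \<times> K)" using fin finU by (simp add: K_def)
    show "0 \<in> V \<times> K" using 0 VU fs0 by (auto simp: K_def zero_prod_def)
    show "x - y \<in> V \<times> K" if "x \<in> V \<times> K" "y \<in> V \<times> K" for x y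
      using that V U fs by (auto simp: K_def)
    show "g (x - y) = g x - g y" for x y
      using f by (auto simp: g_def split: prod.split)
  qed
  moreover have "g ` (V \<times> K) = {v \<in> U. \<exists>u\<in>V. (f ^^ Suc s) u = (f ^^ s) v}"
  proof safe
    fix u x assume u: "u \<in> V" and x: "x \<in> K"
    show "g (u, x) \<in> U" using u x fV Up by (auto simp: g_def K_def)
    show "\<exists>u'\<in>V. (f ^^ Suc s) u' = (f ^^ s) (g (u, x))"
      using u x fsp[of s "f u" x] fS by (intro bexI[of _ u]) (auto simp: g_def K_def)
  next
    fix v u assume v: "v \<in> U" and u: "u \<in> V" and eq: "(f ^^ Suc s) u = (f ^^ s) v"
    have "v - f u \<in> K" using u v fV U eq fs[of s v "f u"] fS[of u] by (auto simp: K_def)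
    moreover have "v = g (u, v - f u)" by (simp add: g_def)
    ultimately show "v \<in> g ` (V \<times> K)" using u by blast
  qed
  moreover have "card {p \<in> V \<times> K. g p = 0} = card {x \<in> V. (f ^^ Suc s) x = 0}"
  proof (rule sym, rule bij_betw_same_card[of "\<lambda>u. (u, - f u)"], rule bij_betw_byWitness[of _ fst])
    show "\<forall>p\<in>{p \<in> V \<times> K. g p = 0}. (fst p, - f (fst p)) = p"
      by (auto simp: g_def dest: minus_unique)
    show "(\<lambda>u. (u, - f u)) ` {x \<in> V. (f ^^ Suc s) x = 0} \<subseteq> {p \<in> V \<times> K. g p = 0}"
      using fV Um fsm fS by (auto simp: g_def K_def)
    show "fst ` {p \<in> V \<times> K. g p = 0} \<subseteq> {x \<in> V. (f ^^ Suc s) x = 0}"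
    proof safe
      fix u x assume "u \<in> V" and x: "x \<in> K" and "g (u, x) = 0"
      then have "f u = - x" by (simp add: g_def eq_neg_iff_add_eq_0)
      then show "(f ^^ Suc s) (fst (u, x)) = 0" using x fsm[of s x] fS[of u] by (simp add: K_def)
    qed simp
  qed simp
  ultimately show ?thesis by (simp add: K_def card_cartesian_product)
qed

section \<open>Column families along the coordinate flag\<close>

text \<open>The coordinate subspace V_m. Vectors are functions on all natural numbers, so subspaces
  of every dimension are subsets of one type and an operator can be restricted to them without
  change.\<close>

definition flag :: "nat \<Rightarrow> (nat \<Rightarrow> 'a::zero) set" where
  "flag m = {v. \<forall>j\<ge>m. v j = 0}"

text \<open>The matrix with columns \<open>w i\<close> applied to \<open>v\<close>. Columns not yet
  chosen will be zero, so the same bound \<open>n\<close> serves every stage of the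
  construction.\<close>

definition colop :: "nat \<Rightarrow> (nat \<Rightarrow> nat \<Rightarrow> 'a::comm_ring_1) \<Rightarrow> (nat \<Rightarrow> 'a) \<Rightarrow> nat \<Rightarrow> 'a" where
  "colop n w v = (\<lambda>j. \<Sum>i<n. v i * w i j)"

lemma flag_mono: "m \<le> m' \<Longrightarrow> flag m \<subseteq> flag m'"
  by (auto simp: flag_def)

lemma zero_mem_flag [simp]: "0 \<in> flag m"
  by (simp add: flag_def)

lemma flag_0: "flag 0 = {0}"
  by (auto simp: flag_def fun_eq_iff)

lemma diff_mem_flag: "x \<in> flag m \<Longrightarrow> y \<in> flag m \<Longrightarrow> (x - y :: nat \<Rightarrow> 'a::ab_group_add) \<in> flag m"
  by (simp add: flag_def)

lemma scale_mem_flag: "x \<in> flag m \<Longrightarrow> (\<lambda>j. c * x j :: 'a::comm_ring_1) \<in> flag m"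
  by (simp add: flag_def)

lemma card_flag:
  "finite (flag m :: (nat \<Rightarrow> 'a::{finite,zero}) set)"
  "card (flag m :: (nat \<Rightarrow> 'a) set) = CARD('a) ^ m"
proof -
  let ?f = "\<lambda>v j. if j < m then v j else (0::'a)"
  have bij: "bij_betw ?f ({..<m} \<rightarrow>\<^sub>E UNIV) (flag m)"
  proof (rule bij_betw_byWitness[of _ "\<lambda>v. restrict v {..<m}"])
    show "\<forall>v\<in>{..<m} \<rightarrow>\<^sub>E UNIV. restrict (?f v) {..<m} = v"
      by (auto simp: fun_eq_iff restrict_def PiE_def extensional_def)
    show "\<forall>v\<in>flag m. ?f (restrict v {..<m}) = v"
      by (auto simp: fun_eq_iff flag_def)
    show "?f ` ({..<m} \<rightarrow>\<^sub>E UNIV) \<subseteq> flag m" by (rule image_subsetI) (simp add: flag_def)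
    show "(\<lambda>v. restrict v {..<m}) ` flag m \<subseteq> {..<m} \<rightarrow>\<^sub>E UNIV"
      by (rule image_subsetI) simp
  qed
  have fin: "finite ({..<m} \<rightarrow>\<^sub>E (UNIV :: 'a set))" by (simp add: finite_PiE)
  show "finite (flag m :: (nat \<Rightarrow> 'a) set)" using bij fin bij_betw_finite by blast
  show "card (flag m :: (nat \<Rightarrow> 'a) set) = CARD('a) ^ m"
    using bij_betw_same_card[OF bij] by (simp add: card_PiE)
qed

lemma colop_diff: "colop n w (x - y) = colop n w x - colop n w y"
  by (simp add: colop_def fun_eq_iff sum_subtractf left_diff_distrib)

lemma colop_scale: "colop n w (\<lambda>j. c * x j) = (\<lambda>j. c * colop n w x j)"
  by (simp add: colop_def fun_eq_iff sum_distrib_left mult.assoc)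

lemmas colop_pow_diff = additive_funpow[of "colop n w" for n w, OF colop_diff]

lemma colop_pow_0: "(colop n w ^^ r) 0 = 0"
  using colop_pow_diff[of r n w 0 0] by simp

lemma colop_pow_scale: "(colop n w ^^ r) (\<lambda>j. c * x j) = (\<lambda>j. c * (colop n w ^^ r) x j)"
  by (induction r) (auto simp: colop_scale)

lemma colop_cong:
  assumes "\<And>i. i < m \<Longrightarrow> w i = w' i" and "x \<in> flag m"
  shows "colop n w x = colop n w' x"
  unfolding colop_def
proof (intro ext sum.cong refl)
  fix j i show "x i * w i j = x i * w' i j"
    using assms by (cases "i < m") (auto simp: flag_def)
qed

lemma colop_mem_flag:
  assumes "\<And>i. i < m \<Longrightarrow> w i \<in> flag l" and "x \<in> flag m"
  shows "colop n w x \<in> flag l"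
proof -
  have "x i * w i j = 0" if "l \<le> j" for i j
    using assms that by (cases "i < m") (auto simp: flag_def)
  then show ?thesis by (simp add: flag_def colop_def)
qed

section \<open>Growth of the kernels along the flag\<close>

definition unit_fun :: "nat \<Rightarrow> nat \<Rightarrow> 'a::zero_neq_one" where
  "unit_fun m = (\<lambda>j. if j = m then 1 else 0)"

lemma colop_unit_fun: "m < n \<Longrightarrow> colop n w (unit_fun m) = w m"
  by (auto simp: colop_def unit_fun_def fun_eq_iff if_distrib[of "\<lambda>x. x * _"] cong: if_cong)

text \<open>For a row word \<rho>, whose letter at position i is the row of the box added there,
  this is the length of row \<open>j\<close> after \<open>m\<close> steps.\<close>

definition row_count :: "(nat \<Rightarrow> nat) \<Rightarrow> nat \<Rightarrow> nat \<Rightarrow> nat" where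
  "row_count \<rho> m j = card {i. i < m \<and> \<rho> i = j}"

lemma row_count_0 [simp]: "row_count \<rho> 0 j = 0"
  by (simp add: row_count_def)

lemma row_count_Suc: "row_count \<rho> (Suc m) j = row_count \<rho> m j + (if \<rho> m = j then 1 else 0)"
proof -
  have "{i. i < Suc m \<and> \<rho> i = j} = {i. i < m \<and> \<rho> i = j} \<union> (if \<rho> m = j then {m} else {})"
    by (auto simp: less_Suc_eq)
  then show ?thesis unfolding row_count_def by (simp add: card_insert_if)
qed

lemma row_count_cong: "(\<And>i. i < m \<Longrightarrow> \<rho> i = \<sigma> i) \<Longrightarrow> row_count \<rho> m j = row_count \<sigma> m j"
  unfolding row_count_def by (rule arg_cong[of _ _ card]) auto

text \<open>Column i is to lie in V_(k i). The bound \<open>k i \<le> i\<close> makes the operator A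
  strictly upper triangular; monotonicity gives A V_m \<subseteq> V_(k m), the inclusion required in
  \<open>card_reachable\<close>.\<close>

locale column_flag =
  fixes n :: nat and k :: "nat \<Rightarrow> nat"
  assumes k_mono: "mono k" and k_le: "k i \<le> i"
begin

text \<open>Columns from \<open>m\<close> on are zero, so a partial matrix has exactly one
  representative and appending a column is a function update.\<close>

definition col_families :: "nat \<Rightarrow> (nat \<Rightarrow> nat \<Rightarrow> 'a::zero) set" where
  "col_families m = {w. (\<forall>i<m. w i \<in> flag (k i)) \<and> (\<forall>i\<ge>m. w i = (\<lambda>_. 0))}"

definition ker_flag :: "(nat \<Rightarrow> nat \<Rightarrow> 'a::comm_ring_1) \<Rightarrow> nat \<Rightarrow> nat \<Rightarrow> (nat \<Rightarrow> 'a) set" where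
  "ker_flag w m r = {x \<in> flag m. (colop n w ^^ r) x = 0}"

text \<open>For a column family this is the subspace A V_m + (V_(k m) \<inter> ker A^s). The
  equation says that, once \<open>v\<close> is column \<open>m\<close>, the vector e_m - u lies in
  ker A^(s+1).\<close>

definition reach :: "(nat \<Rightarrow> nat \<Rightarrow> 'a::comm_ring_1) \<Rightarrow> nat \<Rightarrow> nat \<Rightarrow> (nat \<Rightarrow> 'a) set" where
  "reach w m s = {v \<in> flag (k m). \<exists>u\<in>flag m. (colop n w ^^ Suc s) u = (colop n w ^^ s) v}"

text \<open>The row of the box added in step \<open>m\<close>: the column \<open>w m\<close> lies in \<open>reach w m s\<close> iff that row is at
  most \<open>s\<close>.\<close>

definition row_of :: "(nat \<Rightarrow> nat \<Rightarrow> 'a::comm_ring_1) \<Rightarrow> nat \<Rightarrow> nat" where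
  "row_of w m = (LEAST s. w m \<in> reach w m s)"

lemma col_families_flag_k:
  assumes "w \<in> col_families m" "i < m'"
  shows "w i \<in> flag (k m')"
proof (cases "i < m")
  case True
  then have "w i \<in> flag (k i)" using assms by (simp add: col_families_def)
  moreover have "k i \<le> k m'" using k_mono assms(2) by (simp add: monoD)
  ultimately show ?thesis using flag_mono by blast
qed (use assms in \<open>auto simp: col_families_def flag_def\<close>)

lemma colop_flag_k:
  assumes "w \<in> col_families m" "x \<in> flag m'"
  shows "colop n w x \<in> flag (k m')"
  using colop_mem_flag[OF col_families_flag_k[OF assms(1)] assms(2)] .

lemma colop_pow_flag:
  assumes "w \<in> col_families m" "x \<in> flag m'"
  shows "(colop n w ^^ r) x \<in> flag m'"
proof (induction r)
  case (Suc r)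
  then show ?case using colop_flag_k[OF assms(1) Suc] flag_mono[OF k_le[of m']] by auto
qed (use assms in simp)

lemma colop_pow_cong:
  assumes w: "w \<in> col_families l" and eq: "\<And>i. i < m \<Longrightarrow> w i = w' i" and x: "x \<in> flag m"
  shows "(colop n w ^^ r) x = (colop n w' ^^ r) x"
proof (induction r)
  case (Suc r)
  have "colop n w ((colop n w ^^ r) x) = colop n w' ((colop n w ^^ r) x)"
    by (rule colop_cong[OF eq colop_pow_flag[OF w x]])
  then show ?case using Suc by simp
qed simp

text \<open>Since \<open>k i \<le> i\<close>, the operator maps V_(m+1) into V_m.\<close>

lemma colop_pow_nilpotent:
  assumes w: "w \<in> col_families l" and x: "x \<in> flag m"
  shows "(colop n w ^^ m) x = 0"
  using x
proof (induction m arbitrary: x)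
  case 0
  then show ?case by (simp add: flag_0)
next
  case (Suc m)
  have "colop n w x \<in> flag m"
  proof (rule colop_mem_flag[OF _ Suc.prems])
    fix i assume "i < Suc m"
    then have "k i \<le> m" using k_le[of i] by simp
    moreover have "w i \<in> flag (k i)" using w by (cases "i < l") (auto simp: col_families_def flag_def)
    ultimately show "w i \<in> flag m" using flag_mono by blast
  qed
  then show ?case using Suc.IH by (simp add: funpow_Suc_right del: funpow.simps)
qed

text \<open>Only the columns before \<open>m\<close> act on V_m, and V_(k m) lies in V_m. Hence the
  choices of column \<open>m\<close> that lead to a given row are fixed before this column is
  chosen.\<close>

lemma reach_cong:
  assumes w: "w \<in> col_families l" and eq: "\<And>i. i < m \<Longrightarrow> w i = w' i"
  shows "reach w m s = reach w' m s"
proof -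
  have c: "(colop n w ^^ r) x = (colop n w' ^^ r) x" if "x \<in> flag m" for x r
    by (rule colop_pow_cong[OF w eq that])
  have "flag (k m) \<subseteq> (flag m :: (nat \<Rightarrow> 'a) set)" using flag_mono[OF k_le] .
  then show ?thesis unfolding reach_def using c
    by (intro Collect_cong conj_cong bex_cong refl) (metis subsetD)
qed

text \<open>Applying the operator to both sides of the defining equation passes from
  \<open>s\<close> to \<open>Suc s\<close>.\<close>

lemma reach_mono:
  assumes "s \<le> s'" shows "reach w m s \<subseteq> reach w m s'"
proof -
  have "reach w m s \<subseteq> reach w m (Suc s)" for s
  proof
    fix v assume "v \<in> reach w m s"
    then obtain u where "v \<in> flag (k m)" "u \<in> flag m" "(colop n w ^^ Suc s) u = (colop n w ^^ s) v"
      by (auto simp: reach_def)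
    then have "colop n w ((colop n w ^^ Suc s) u) = colop n w ((colop n w ^^ s) v)" by simp
    then show "v \<in> reach w m (Suc s)" using \<open>v \<in> flag (k m)\<close> \<open>u \<in> flag m\<close> by (auto simp: reach_def)
  qed
  then show ?thesis using assms by (rule lift_Suc_mono_le)
qed

text \<open>The \<open>m\<close>-th power kills V_m, so \<open>u = 0\<close> solves the defining
  equation. This ensures that the minimum in \<open>row_of\<close> exists.\<close>

lemma reach_eventually:
  assumes "w \<in> col_families l" shows "reach w m m = flag (k m)"
proof -
  have "(colop n w ^^ Suc m) 0 = (colop n w ^^ m) v" if "v \<in> flag (k m)" for v
    using colop_pow_nilpotent[OF assms, of v m] that flag_mono[OF k_le[of m]] colop_pow_0
    by (metis subsetD)
  then show ?thesis unfolding reach_def by (auto intro!: bexI[of _ 0])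
qed

lemma row_of_le_iff:
  assumes w: "w \<in> col_families l" and m: "m < l"
  shows "row_of w m \<le> s \<longleftrightarrow> w m \<in> reach w m s"
proof
  have "w m \<in> reach w m m" using reach_eventually[OF w] w m by (simp add: col_families_def)
  then have "w m \<in> reach w m (row_of w m)" unfolding row_of_def by (rule LeastI)
  then show "row_of w m \<le> s \<Longrightarrow> w m \<in> reach w m s" using reach_mono by blast
qed (simp add: row_of_def Least_le)

lemma ker_flag_0: "ker_flag w m 0 = {0}"
  by (auto simp: ker_flag_def)

lemma ker_flag_subgroup:
  "0 \<in> ker_flag w m r"
  "x \<in> ker_flag w m r \<Longrightarrow> y \<in> ker_flag w m r \<Longrightarrow> x - y \<in> ker_flag w m r"
  by (auto simp: ker_flag_def colop_pow_0 colop_pow_diff intro: diff_mem_flag)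

lemma scale_mem_ker_flag:
  "x \<in> ker_flag w m r \<Longrightarrow> (\<lambda>j. c * x j) \<in> ker_flag w m r"
  by (auto simp: ker_flag_def colop_pow_scale scale_mem_flag fun_eq_iff)

lemma finite_ker_flag: "finite (ker_flag w m r :: (nat \<Rightarrow> 'a::{comm_ring_1,finite}) set)"
  unfolding ker_flag_def using card_flag(1)[of m] by (rule rev_finite_subset) auto

text \<open>Evaluation at coordinate \<open>m\<close> on V_(m+1) \<inter> ker A^(s+1) has kernel V_m
  \<inter> ker A^(s+1), and its image, being closed under scaling, is the field or 0. It is the
  field exactly when some e_m - u with u in V_m lies in ker A^(s+1).\<close>

lemma card_ker_flag_Suc:
  fixes w :: "nat \<Rightarrow> nat \<Rightarrow> 'a::{field,finite}"
  assumes w: "w \<in> col_families l" and m: "m < l" "l \<le> n"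
  shows "card (ker_flag w (Suc m) (Suc s)) =
    (if w m \<in> reach w m s then CARD('a) else 1) * card (ker_flag w m (Suc s))"
proof -
  let ?K = "ker_flag w (Suc m) (Suc s)" and ?f = "colop n w"
  have "card ?K = card ((\<lambda>x. x m) ` ?K) * card {x \<in> ?K. x m = 0}"
    by (rule card_additive_image) (simp_all add: finite_ker_flag ker_flag_subgroup)
  moreover have "{x \<in> ?K. x m = 0} = ker_flag w m (Suc s)"
    unfolding ker_flag_def flag_def by (auto simp: Suc_le_eq) (metis order_le_less)
  moreover have unit: "(?f ^^ Suc s) (unit_fun m) = (?f ^^ s) (w m)"
    using m by (simp add: funpow_Suc_right colop_unit_fun del: funpow.simps)
  have "(\<lambda>x. x m) ` ?K = UNIV" if "w m \<in> reach w m s"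
  proof -
    obtain u where u: "u \<in> flag m" "(?f ^^ Suc s) u = (?f ^^ s) (w m)"
      using \<open>w m \<in> reach w m s\<close> by (auto simp: reach_def)
    have z: "unit_fun m - u \<in> ?K"
      using u colop_pow_diff[of "Suc s" n w "unit_fun m" u] unit
      by (auto simp: ker_flag_def flag_def unit_fun_def)
    have "c \<in> (\<lambda>x. x m) ` ?K" for c
      by (rule image_eqI[OF _ scale_mem_ker_flag[OF z, of c]]) (use u in \<open>simp add: flag_def unit_fun_def\<close>)
    then show ?thesis by blast
  qed
  moreover have "(\<lambda>x. x m) ` ?K = {0}" if "w m \<notin> reach w m s"
  proof -
    have "x m = 0" if x: "x \<in> ?K" for x
    proof (rule ccontr)
      assume nz: "x m \<noteq> 0"
      \<comment> \<open>Scaling x to have coordinate 1 at \<open>m\<close> turns it into e_m - u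
        with u in V_m, which would put \<open>w m\<close> into \<open>reach w m s\<close>.\<close>
      define u where "u = unit_fun m - (\<lambda>j. inverse (x m) * x j)"
      have y: "(\<lambda>j. inverse (x m) * x j) \<in> ?K" by (rule scale_mem_ker_flag[OF x])
      have "u \<in> flag m"
        using x nz by (auto simp: u_def flag_def unit_fun_def ker_flag_def Suc_le_eq)
      moreover have "(?f ^^ Suc s) u = (?f ^^ s) (w m)"
        using y unfolding u_def colop_pow_diff unit by (simp add: ker_flag_def)
      moreover have "w m \<in> flag (k m)" using w m by (simp add: col_families_def)
      ultimately show False using \<open>w m \<notin> reach w m s\<close> by (auto simp: reach_def)
    qed
    moreover have "0 \<in> (\<lambda>x. x m) ` ?K"
      using ker_flag_subgroup(1)[of w "Suc m" "Suc s"] by (intro image_eqI[of _ _ 0]) simp_all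
    ultimately show ?thesis by blast
  qed
  ultimately show ?thesis by (cases "w m \<in> reach w m s") auto
qed

text \<open>Passing from V_m to V_(m+1) enlarges ker A^r by one dimension exactly when the new box
  lies in one of the first r rows. The row lengths are thus the parts of the conjugate of the Jordan
  type on V_m.\<close>

lemma card_ker_flag:
  fixes w :: "nat \<Rightarrow> nat \<Rightarrow> 'a::{field,finite}"
  assumes w: "w \<in> col_families l" and m: "m \<le> l" "l \<le> n"
  shows "card (ker_flag w m r) = CARD('a) ^ (\<Sum>j<r. row_count (row_of w) m j)"
  using m(1)
proof (induction m arbitrary: r)
  case 0
  have "ker_flag w 0 r = {0}" by (auto simp: ker_flag_def flag_0 colop_pow_0)
  then show ?case by simp
next
  case (Suc m)
  show ?case
  proof (cases r)
    case 0
    then show ?thesis by (simp add: ker_flag_0)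
  next
    case (Suc s)
    have "(\<Sum>j<Suc s. row_count (row_of w) (Suc m) j) =
        (\<Sum>j<Suc s. row_count (row_of w) m j) + (if row_of w m \<le> s then 1 else 0)"
      by (simp add: row_count_Suc sum.distrib less_Suc_eq_le del: sum.lessThan_Suc)
    then show ?thesis
      using card_ker_flag_Suc[OF w _ m(2), of m s] Suc Suc.IH[of r] Suc.prems row_of_le_iff[OF w, of m s]
      by (simp add: power_add)
  qed
qed

section \<open>Counting column families with a given row word\<close>

text \<open>The dimension of \<open>reach w m s\<close> read off from the word: dim V_m + dim (V_(k
  m) \<inter> ker A^s) - dim (V_m \<inter> ker A^(s+1)). Integers avoid truncated
  subtraction.\<close>

definition reach_exp :: "(nat \<Rightarrow> nat) \<Rightarrow> nat \<Rightarrow> nat \<Rightarrow> int" where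
  "reach_exp \<rho> m s = int m + (\<Sum>j<s. int (row_count \<rho> (k m) j)) - (\<Sum>j<Suc s. int (row_count \<rho> m j))"

text \<open>The number of columns that put the new box in row \<open>\<rho> m\<close>. Outside row 0
  it is the difference of two consecutive \<open>reach\<close> sizes, whose exponents differ by the
  difference of row counts in the body; the value 0 belongs to words that cannot be
  continued.\<close>

definition step_factor :: "real \<Rightarrow> (nat \<Rightarrow> nat) \<Rightarrow> nat \<Rightarrow> real" where
  "step_factor q \<rho> m =
    (if \<rho> m = 0 then q powi reach_exp \<rho> m 0
     else if row_count \<rho> m (\<rho> m) < row_count \<rho> (k m) (\<rho> m - 1)
     then q powi reach_exp \<rho> m (\<rho> m) *
       (1 - (1 / q) ^ (row_count \<rho> (k m) (\<rho> m - 1) - row_count \<rho> m (\<rho> m)))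
     else 0)"

definition word_families :: "nat \<Rightarrow> (nat \<Rightarrow> nat) \<Rightarrow> (nat \<Rightarrow> nat \<Rightarrow> 'a::comm_ring_1) set" where
  "word_families m \<rho> = {w \<in> col_families m. \<forall>i<m. row_of w i = \<rho> i}"

text \<open>The case U = V_(k m), V = V_m of \<open>card_reachable\<close>, with both kernel sizes
  supplied by \<open>card_ker_flag\<close>.\<close>

lemma card_reach:
  fixes w :: "nat \<Rightarrow> nat \<Rightarrow> 'a::{field,finite}"
  assumes w: "w \<in> col_families m" and m: "m \<le> n"
  shows "real (card (reach w m s)) = real CARD('a) powi reach_exp (row_of w) m s"
proof -
  let ?q = "CARD('a)"
  have q: "real ?q \<noteq> 0" by simp
  have "card (reach w m s) * card (ker_flag w m (Suc s)) =
      card (flag m :: (nat \<Rightarrow> 'a) set) * card (ker_flag w (k m) s)"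
    unfolding reach_def ker_flag_def
    by (rule card_reachable)
      (use flag_mono[OF k_le[of m]] colop_flag_k[OF w] in \<open>auto simp: card_flag diff_mem_flag colop_diff\<close>)
  then have "card (reach w m s) * ?q ^ (\<Sum>j<Suc s. row_count (row_of w) m j) =
      ?q ^ (m + (\<Sum>j<s. row_count (row_of w) (k m) j))"
    by (simp only: card_flag card_ker_flag[OF w order_refl m] card_ker_flag[OF w k_le m] power_add)
  then have "real (card (reach w m s)) * real ?q ^ (\<Sum>j<Suc s. row_count (row_of w) m j) =
      real ?q ^ (m + (\<Sum>j<s. row_count (row_of w) (k m) j))"
    by (metis of_nat_mult of_nat_power)
  moreover have "reach_exp (row_of w) m s =
      int (m + (\<Sum>j<s. row_count (row_of w) (k m) j)) - int (\<Sum>j<Suc s. row_count (row_of w) m j)"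
    by (simp add: reach_exp_def)
  ultimately show ?thesis
    using q by (simp add: power_int_diff eq_divide_eq del: sum.lessThan_Suc of_nat_sum of_nat_add)
qed

text \<open>Because the \<open>reach\<close> sets are nested, minimality of the row leaves the
  difference of two consecutive ones.\<close>

lemma card_fibre:
  fixes w :: "nat \<Rightarrow> nat \<Rightarrow> 'a::{field,finite}"
  assumes w: "w \<in> word_families m \<rho>" and m: "m \<le> n"
  shows "real (card {v \<in> reach w m (\<rho> m). \<forall>s<\<rho> m. v \<notin> reach w m s}) = step_factor (real CARD('a)) \<rho> m"
proof -
  let ?q = "real CARD('a)"
  have w': "w \<in> col_families m" using w by (simp add: word_families_def)
  have q: "1 < ?q" using card_field_gt_1[where 'a = 'a] by simp
  have rc: "row_count (row_of w) i j = row_count \<rho> i j" if "i \<le> m" for i j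
    using w that by (intro row_count_cong) (simp add: word_families_def)
  have cr: "real (card (reach w m s)) = ?q powi reach_exp \<rho> m s" for s
    using card_reach[OF w' m, of s] by (simp add: reach_exp_def rc k_le)
  show ?thesis
  proof (cases "\<rho> m")
    case 0
    then show ?thesis using cr[of 0] by (simp add: step_factor_def)
  next
    case (Suc s)
    have fin: "finite (reach w m s)"
      unfolding reach_def using card_flag(1)[of "k m"] by (rule rev_finite_subset) auto
    have sub: "reach w m s \<subseteq> reach w m (Suc s)" by (rule reach_mono) simp
    have "{v \<in> reach w m (\<rho> m). \<forall>s<\<rho> m. v \<notin> reach w m s} = reach w m (Suc s) - reach w m s"
      unfolding Suc using reach_mono[of _ s w m] by (auto simp: less_Suc_eq_le)
    then have diff: "real (card {v \<in> reach w m (\<rho> m). \<forall>s<\<rho> m. v \<notin> reach w m s}) =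
        ?q powi reach_exp \<rho> m (Suc s) - ?q powi reach_exp \<rho> m s"
      using fin sub by (simp add: card_Diff_subset card_mono cr[symmetric] reach_def card_flag)
    have le: "?q powi reach_exp \<rho> m s \<le> ?q powi reach_exp \<rho> m (Suc s)"
      unfolding cr[symmetric] using sub card_flag(1)[of "k m"]
      by (intro of_nat_mono card_mono) (auto simp: reach_def)
    have eq: "reach_exp \<rho> m s =
        reach_exp \<rho> m (Suc s) - (int (row_count \<rho> (k m) s) - int (row_count \<rho> m (Suc s)))"
      by (simp add: reach_exp_def)
    show ?thesis
    proof (cases "row_count \<rho> m (Suc s) < row_count \<rho> (k m) s")
      case True
      then have "reach_exp \<rho> m s = reach_exp \<rho> m (Suc s) - int (row_count \<rho> (k m) s - row_count \<rho> m (Suc s))"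
        using eq by (simp add: of_nat_diff)
      then have "?q powi reach_exp \<rho> m s =
          ?q powi reach_exp \<rho> m (Suc s) * (1 / ?q) ^ (row_count \<rho> (k m) s - row_count \<rho> m (Suc s))"
        using q by (simp add: power_int_diff power_divide)
      with True diff show ?thesis by (simp add: step_factor_def Suc algebra_simps)
    next
      case False
      \<comment> \<open>Here the exponent does not grow from \<open>s\<close> to
        \<open>Suc s\<close>. With the inclusion of the two sets this forces equal sizes, so no
        column lands in this row.\<close>
      then have "reach_exp \<rho> m (Suc s) \<le> reach_exp \<rho> m s" using eq by simp
      then have "?q powi reach_exp \<rho> m (Suc s) \<le> ?q powi reach_exp \<rho> m s"
        using q by (intro power_int_increasing) simp_all
      with False le diff show ?thesis by (simp add: step_factor_def Suc)
    qed
  qed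
qed

text \<open>By \<open>reach_cong\<close>, setting column \<open>m\<close> leaves the rows of the
  earlier columns unchanged and the condition on the new column depends on the earlier ones
  only.\<close>

lemma word_families_Suc:
  fixes \<rho> :: "nat \<Rightarrow> nat"
  defines "fibre \<equiv> \<lambda>m w. {v \<in> reach w m (\<rho> m). \<forall>s<\<rho> m. v \<notin> reach w m s}"
  shows "bij_betw (\<lambda>(w, v). w(m := v)) (SIGMA w:word_families m \<rho>. fibre m w)
    (word_families (Suc m) \<rho> :: (nat \<Rightarrow> nat \<Rightarrow> 'a::{field,finite}) set)"
proof -
  have fam: "w(m := v) \<in> col_families (Suc m) \<longleftrightarrow> w \<in> col_families m \<and> v \<in> flag (k m)"
    if "w m = (\<lambda>_. 0)" for w and v :: "nat \<Rightarrow> 'a"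
  proof -
    have "(\<forall>i\<ge>Suc m. w i = (\<lambda>_. 0)) \<longleftrightarrow> (\<forall>i\<ge>m. w i = (\<lambda>_. 0))"
      using that by (metis Suc_leD le_antisym not_less_eq_eq)
    then show ?thesis by (auto simp: col_families_def All_less_Suc)
  qed
  have row_cong: "row_of (w(m := v)) i = row_of w i"
    if "w \<in> col_families m" "i < m" for w i and v :: "nat \<Rightarrow> 'a"
    unfolding row_of_def using reach_cong[OF that(1), of i "w(m := v)"] that(2) by simp
  have row: "row_of (w(m := v)) m = \<rho> m \<longleftrightarrow> v \<in> fibre m w"
    if w: "w \<in> col_families m" and v: "v \<in> flag (k m)" for w and v :: "nat \<Rightarrow> 'a"
  proof -
    have z: "w m = (\<lambda>_. 0)" using w by (simp add: col_families_def)
    have "reach (w(m := v)) m s = reach w m s" for s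
      using reach_cong[OF w, of m "w(m := v)" s] by simp
    then have "row_of (w(m := v)) m \<le> s \<longleftrightarrow> v \<in> reach w m s" for s
      using row_of_le_iff[of "w(m := v)" "Suc m" m s] fam[of w v, OF z] w v by simp
    then have "v \<in> fibre m w \<longleftrightarrow> row_of (w(m := v)) m \<le> \<rho> m \<and> (\<forall>s<\<rho> m. \<not> row_of (w(m := v)) m \<le> s)"
      by (simp add: fibre_def)
    also have "\<dots> \<longleftrightarrow> row_of (w(m := v)) m = \<rho> m"
      by (cases "row_of (w(m := v)) m" "\<rho> m" rule: linorder_cases) auto
    finally show ?thesis ..
  qed
  have fibre_flag: "fibre m w \<subseteq> flag (k m)" for w :: "nat \<Rightarrow> nat \<Rightarrow> 'a"
    by (auto simp: fibre_def reach_def)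
  have word: "w(m := v) \<in> word_families (Suc m) \<rho> \<longleftrightarrow> w \<in> word_families m \<rho> \<and> v \<in> fibre m w"
    if z: "w m = (\<lambda>_. 0)" for w and v :: "nat \<Rightarrow> 'a"
    using fam[of w v, OF z] row row_cong fibre_flag[of w] unfolding word_families_def
    by (auto simp: less_Suc_eq)
  have zero: "w m = (\<lambda>_. 0)" if "w \<in> word_families m \<rho>" for w :: "nat \<Rightarrow> nat \<Rightarrow> 'a"
    using that by (simp add: word_families_def col_families_def)
  show ?thesis
  proof (rule bij_betw_byWitness[of _ "\<lambda>w. (w(m := (\<lambda>_. 0)), w m)"])
    show "\<forall>p\<in>SIGMA w:word_families m \<rho>. fibre m w.
        (\<lambda>w. (w(m := (\<lambda>_. 0)), w m)) ((\<lambda>(w, v). w(m := v)) p) = p"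
      using zero by (auto simp: fun_eq_iff)
    show "(\<lambda>(w, v). w(m := v)) ` (SIGMA w:word_families m \<rho>. fibre m w) \<subseteq> word_families (Suc m) \<rho>"
      using word zero by auto
    show "(\<lambda>w. (w(m := (\<lambda>_. 0)), w m)) ` word_families (Suc m) \<rho> \<subseteq> (SIGMA w:word_families m \<rho>. fibre m w)"
    proof (rule image_subsetI)
      fix w :: "nat \<Rightarrow> nat \<Rightarrow> 'a" assume "w \<in> word_families (Suc m) \<rho>"
      then have "(w(m := (\<lambda>_. 0)))(m := w m) \<in> word_families (Suc m) \<rho>" by simp
      then show "(w(m := (\<lambda>_. 0)), w m) \<in> (SIGMA w:word_families m \<rho>. fibre m w)"
        using word[of "w(m := (\<lambda>_. 0))" "w m"] by simp
    qed
  qed simp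
qed

text \<open>By \<open>card_fibre\<close> the number of continuations depends on the word but not on
  the family, so the counts multiply.\<close>

lemma finite_card_word_families:
  assumes "m \<le> n"
  shows "finite (word_families m \<rho> :: (nat \<Rightarrow> nat \<Rightarrow> 'a::{field,finite}) set) \<and>
    real (card (word_families m \<rho> :: (nat \<Rightarrow> nat \<Rightarrow> 'a) set)) =
      (\<Prod>i<m. step_factor (real CARD('a)) \<rho> i)"
  using assms
proof (induction m)
  case 0
  have "word_families 0 \<rho> = {(\<lambda>_ _. 0) :: nat \<Rightarrow> nat \<Rightarrow> 'a}"
    by (auto simp: word_families_def col_families_def)
  then show ?case by simp
next
  case (Suc m)
  let ?W = "word_families m \<rho> :: (nat \<Rightarrow> nat \<Rightarrow> 'a) set"
  let ?F = "\<lambda>w :: nat \<Rightarrow> nat \<Rightarrow> 'a. {v \<in> reach w m (\<rho> m). \<forall>s<\<rho> m. v \<notin> reach w m s}"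
  note bij = word_families_Suc[of m \<rho>, where 'a = 'a]
  have IH: "finite ?W" "real (card ?W) = (\<Prod>i<m. step_factor (real CARD('a)) \<rho> i)"
    using Suc by simp_all
  have finF: "finite (?F w)" for w
    using card_flag(1)[of "k m"] by (rule rev_finite_subset) (auto simp: reach_def)
  have "finite (Sigma ?W ?F)" using IH(1) finF by blast
  moreover have "real (card (Sigma ?W ?F)) = (\<Sum>w\<in>?W. real (card (?F w)))"
    using IH(1) finF by (simp add: card_SigmaI)
  then have "real (card (Sigma ?W ?F)) = (\<Prod>i<Suc m. step_factor (real CARD('a)) \<rho> i)"
    using card_fibre[where 'a = 'a, of _ m \<rho>] Suc.prems IH(2) by simp
  ultimately show ?case using bij_betw_finite[OF bij] bij_betw_same_card[OF bij] by simp
qed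

end

section \<open>Nilpotent classes and kernels of powers\<close>

lemma (in vectorspace) card_carrier_eq_power_dim:
  assumes B: "finite B" "basis B"
  shows "card (carrier V) = card (carrier K) ^ dim"
proof -
  have BV: "B \<subseteq> carrier V" using B by (auto simp: basis_def)
  have ex1: "\<forall>v. v \<in> carrier V \<longrightarrow> (\<exists>!a. a \<in> B \<rightarrow>\<^sub>E carrier K \<and> lincomb a B = v)"
    using basis_criterion[OF B(1) BV] B(2) by blast
  have "bij_betw (\<lambda>a. lincomb a B) (B \<rightarrow>\<^sub>E carrier K) (carrier V)"
  proof (rule bij_betwI')
    fix a b assume a: "a \<in> B \<rightarrow>\<^sub>E carrier K" and b: "b \<in> B \<rightarrow>\<^sub>E carrier K"
    have "lincomb a B \<in> carrier V" using a BV by (intro lincomb_closed) auto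
    then show "lincomb a B = lincomb b B \<longleftrightarrow> a = b" using ex1 a b by metis
  next
    fix a assume "a \<in> B \<rightarrow>\<^sub>E carrier K"
    then show "lincomb a B \<in> carrier V" using BV by (intro lincomb_closed) auto
  next
    fix v assume "v \<in> carrier V"
    then show "\<exists>a\<in>B \<rightarrow>\<^sub>E carrier K. v = lincomb a B" using ex1 by metis
  qed
  then have "card (carrier V) = card (B \<rightarrow>\<^sub>E carrier K)" by (metis bij_betw_same_card)
  then show ?thesis using B by (simp add: card_PiE dim_basis)
qed

lemma card_mat_kernel:
  fixes A :: "'a::{field,finite} mat"
  assumes A: "A \<in> carrier_mat nr nc"
  shows "card (mat_kernel A) = CARD('a) ^ kernel_dim A"
proof -
  interpret kernel nr nc A by unfold_locales (rule A)
  obtain B where "finite B" "basis B" using kernel_basis_exists[OF A] by blast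
  from Ker.card_carrier_eq_power_dim[OF this] show ?thesis by simp
qed

section \<open>Order of the Jordan blocks\<close>

text \<open>Conjugation by the permutation matrix that exchanges the two groups of
  coordinates.\<close>

lemma similar_mat_four_block_swap:
  fixes A B :: "'a::field mat"
  assumes A: "A \<in> carrier_mat n n" and B: "B \<in> carrier_mat m m"
  shows "similar_mat (four_block_mat A (0\<^sub>m n m) (0\<^sub>m m n) B)
    (four_block_mat B (0\<^sub>m m n) (0\<^sub>m n m) A)"
proof -
  let ?P = "four_block_mat (0\<^sub>m n m) (1\<^sub>m n) (1\<^sub>m m) (0\<^sub>m m n) :: 'a mat"
  let ?Q = "four_block_mat (0\<^sub>m m n) (1\<^sub>m m) (1\<^sub>m n) (0\<^sub>m n m) :: 'a mat"
  let ?X = "four_block_mat A (0\<^sub>m n m) (0\<^sub>m m n) B"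
  let ?Y = "four_block_mat B (0\<^sub>m m n) (0\<^sub>m n m) A"
  have PY: "?P * ?Y = four_block_mat (0\<^sub>m n m) A B (0\<^sub>m m n)"
    using A B by (subst mult_four_block_mat[of _ n m _ n _ m]) auto
  have "similar_mat_wit ?X ?Y ?P ?Q"
  proof (rule similar_mat_witI[of _ _ "n + m"])
    show "?P * ?Q = 1\<^sub>m (n + m)"
      by (subst mult_four_block_mat[of _ n m _ n _ m]) auto
    have "?Q * ?P = 1\<^sub>m (m + n)"
      by (subst mult_four_block_mat[of _ m n _ m _ n]) auto
    then show "?Q * ?P = 1\<^sub>m (n + m)" by (simp add: add.commute)
    show "?X = ?P * ?Y * ?Q"
      unfolding PY using A B by (subst mult_four_block_mat[of _ n m _ n _ m]) auto
    show "?X \<in> carrier_mat (n + m) (n + m)" using four_block_carrier_mat[OF A B] .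
    show "?Y \<in> carrier_mat (n + m) (n + m)" using four_block_carrier_mat[OF B A] by (simp add: add.commute)
    show "?P \<in> carrier_mat (n + m) (n + m)" "?Q \<in> carrier_mat (n + m) (n + m)" by (rule carrier_matI; simp)+
  qed
  then show ?thesis unfolding similar_mat_def by blast
qed

lemma jordan_matrix_append:
  "jordan_matrix (xs @ ys) = four_block_mat (jordan_matrix xs)
     (0\<^sub>m (sum_list (map fst xs)) (sum_list (map fst ys)))
     (0\<^sub>m (sum_list (map fst ys)) (sum_list (map fst xs))) (jordan_matrix ys)"
  using jordan_matrix_dim[of xs] jordan_matrix_dim[of ys]
  by (simp add: jordan_matrix_def diag_block_mat_append Let_def)

lemma similar_mat_jordan_matrix_append:
  fixes xs :: "(nat \<times> 'a::field) list"
  assumes "similar_mat (jordan_matrix xs) (jordan_matrix xs')"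
    and "similar_mat (jordan_matrix ys) (jordan_matrix ys')"
  shows "similar_mat (jordan_matrix (xs @ ys)) (jordan_matrix (xs' @ ys'))"
proof -
  \<comment> \<open>Similar matrices have equal size, so the zero blocks on both sides have matching
    dimensions.\<close>
  have dim: "sum_list (map fst bs) = sum_list (map fst as)"
    if sim: "similar_mat (jordan_matrix as) (jordan_matrix bs)" for as bs :: "(nat \<times> 'a) list"
  proof -
    obtain k where "jordan_matrix as \<in> carrier_mat k k" "jordan_matrix bs \<in> carrier_mat k k"
      using similar_matD[OF sim] by blast
    then show ?thesis by (metis carrier_matD(1) jordan_matrix_dim(1))
  qed
  note dim[OF assms(1)] dim[OF assms(2)]
  then show ?thesis
    unfolding jordan_matrix_append using similar_mat_four_block_0_0[OF assms jordan_matrix_carrier jordan_matrix_carrier]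
    by simp
qed

text \<open>The class is defined through blocks in the order of \<mu>, whereas a Jordan form of a
  given matrix lists them in some other order; only the multisets can be compared.\<close>

lemma similar_mat_jordan_matrix_mset:
  fixes xs ys :: "(nat \<times> 'a::field) list"
  assumes "mset xs = mset ys"
  shows "similar_mat (jordan_matrix xs) (jordan_matrix ys)"
  using assms
proof (induction xs arbitrary: ys)
  case Nil
  then show ?case using similar_mat_refl[OF jordan_matrix_carrier] by simp
next
  case (Cons x xs)
  obtain as bs where ys: "ys = as @ x # bs"
    using Cons.prems by (metis in_set_conv_decomp list.set_intros(1) set_mset_mset)
  then have "mset xs = mset (as @ bs)" using Cons.prems by simp
  then have "similar_mat (jordan_matrix ([x] @ xs)) (jordan_matrix ([x] @ (as @ bs)))"
    by (intro similar_mat_jordan_matrix_append Cons.IH similar_mat_refl[OF jordan_matrix_carrier])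
  moreover have "similar_mat (jordan_matrix ([x] @ as)) (jordan_matrix (as @ [x]))"
    unfolding jordan_matrix_append by (rule similar_mat_four_block_swap) (rule jordan_matrix_carrier)+
  then have "similar_mat (jordan_matrix (([x] @ as) @ bs)) (jordan_matrix ((as @ [x]) @ bs))"
    by (rule similar_mat_jordan_matrix_append[OF _ similar_mat_refl[OF jordan_matrix_carrier]])
  ultimately show ?case unfolding ys by (auto intro: similar_mat_trans)
qed

section \<open>Jordan types of strictly upper triangular matrices\<close>

lemma char_matrix_0: "A \<in> carrier_mat n n \<Longrightarrow> char_matrix A (0::'a::field) = A"
  unfolding char_matrix_def by (intro eq_matI) auto

text \<open>A triangular matrix has a Jordan form over its own field, and the characteristic
  polynomial X^n leaves 0 as the only eigenvalue.\<close>

lemma strict_upper_triangular_jordan_nf: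
  fixes A :: "'a::field mat"
  assumes A: "A \<in> carrier_mat n n" and up: "\<And>i j. j \<le> i \<Longrightarrow> i < n \<Longrightarrow> A $$ (i, j) = 0"
  obtains n_as where "jordan_nf A n_as" "snd ` set n_as \<subseteq> {0}"
proof -
  have ut: "upper_triangular A" using A up by (auto simp: upper_triangular_def)
  have jnf: "jordan_nf A (triangular_to_jnf_vector A)" (is "jordan_nf A ?ns")
    using triangular_to_jnf_vector[OF A ut] .
  have "diag_mat A = replicate n 0" using A up
    by (auto simp: diag_mat_def intro!: nth_equalityI)
  then have cp: "char_poly A = [:0, 1:] ^ n"
    using char_poly_upper_triangular[OF A ut] by simp
  \<comment> \<open>The size of a block is bounded by the multiplicity of its eigenvalue as a root,
    which is 0 for \<open>a \<noteq> 0\<close>, while blocks of a Jordan form have positive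
    size.\<close>
  have "a = 0" if mem: "(k, a) \<in> set ?ns" for k a
  proof (rule ccontr)
    assume "a \<noteq> 0"
    then have "Polynomial.order a (char_poly A) = 0"
      unfolding cp by (intro order_0I) (simp add: poly_power)
    moreover have "k \<noteq> 0" using jnf mem by (force simp: jordan_nf_def)
    ultimately show False using jordan_nf_block_size_order_bound[OF jnf mem] by simp
  qed
  then have "snd ` set ?ns \<subseteq> {0}" by fastforce
  then show ?thesis using that[OF jnf] by simp
qed

text \<open>The r-th power of a nilpotent block of size m has a kernel of dimension min r m.
  Conversely, the kernel dimensions of all powers determine how many blocks of each size occur,
  hence the class.\<close>

lemma mem_nilp_class_iff:
  fixes A :: "'a::{field,finite} mat"
  assumes A: "A \<in> carrier_mat n n" and up: "\<And>i j. j \<le> i \<Longrightarrow> i < n \<Longrightarrow> A $$ (i, j) = 0"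
    and pos: "\<forall>m\<in>set \<mu>. 0 < m"
  shows "A \<in> nilp_class \<mu> \<longleftrightarrow>
    (\<forall>r. card (mat_kernel (A ^\<^sub>m r)) = CARD('a) ^ (\<Sum>m\<leftarrow>\<mu>. min r m))"
proof -
  let ?J = "map (\<lambda>m. (m, 0::'a)) \<mu>"
  have dimJ: "dim_gen_eigenspace (jordan_matrix ?J) 0 r = (\<Sum>m\<leftarrow>\<mu>. min r m)" for r
    unfolding dim_gen_eigenspace_jordan_matrix by (simp add: filter_map o_def)
  have "card (mat_kernel (A ^\<^sub>m r)) = CARD('a) ^ dim_gen_eigenspace A 0 r" for r
    unfolding dim_gen_eigenspace_def char_matrix_0[OF A] using card_mat_kernel[of "A ^\<^sub>m r" n n] A by simp
  then have "(\<forall>r. card (mat_kernel (A ^\<^sub>m r)) = CARD('a) ^ (\<Sum>m\<leftarrow>\<mu>. min r m)) \<longleftrightarrow>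
      (\<forall>r. dim_gen_eigenspace A 0 r = dim_gen_eigenspace (jordan_matrix ?J) 0 r)" (is "?L \<longleftrightarrow> ?R")
    using card_field_gt_1[where 'a = 'a] by (simp add: dimJ)
  moreover have "A \<in> nilp_class \<mu> \<longleftrightarrow> ?R"
  proof
    assume "A \<in> nilp_class \<mu>"
    then show ?R using dim_gen_eigenspace_similar[of A "jordan_matrix ?J"]
      by (simp add: nilp_class_def nilp_jordan_def)
  next
    assume eq: ?R
    obtain n_as where jnf: "jordan_nf A n_as" and 0: "snd ` set n_as \<subseteq> {0}"
      using strict_upper_triangular_jordan_nf[OF A up] by blast
    have jnf': "jordan_nf (jordan_matrix ?J) ?J"
      using pos by (auto simp: jordan_nf_def intro!: similar_mat_refl[OF jordan_matrix_carrier])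
    have "mset n_as = mset ?J"
    proof (rule multiset_eqI)
      fix x :: "nat \<times> 'a"
      obtain k a where x: "x = (k, a)" by fastforce
      \<comment> \<open>The block-counting formula is applied to positive sizes and eigenvalue 0;
        all other blocks occur in neither list.\<close>
      have zero: "count (mset xs) x = 0" if "k = 0 \<or> a \<noteq> 0" "0 \<notin> fst ` set xs" "snd ` set xs \<subseteq> {0}" for xs
        using that unfolding x by (force simp: count_eq_zero_iff)
      have cnt: "count (mset xs) x = length (filter ((=) x) xs)" for xs by (induction xs) auto
      show "count (mset n_as) x = count (mset ?J) x"
      proof (cases "k = 0 \<or> a \<noteq> 0")
        case True
        have "count (mset n_as) x = 0" using zero[OF True _ 0] jnf by (simp add: jordan_nf_def)
        moreover have "count (mset ?J) x = 0"
          using zero[OF True, of ?J] jnf' by (force simp: jordan_nf_def)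
        ultimately show ?thesis by (rule trans[OF _ sym])
      next
        case False
        then have "length (filter ((=) x) n_as) = length (filter ((=) x) ?J)"
          using compute_nr_of_jordan_blocks[OF jnf, of k 0] compute_nr_of_jordan_blocks[OF jnf', of k 0] eq
          unfolding x by (simp add: compute_nr_of_jordan_blocks_def)
        then show ?thesis unfolding cnt .
      qed
    qed
    then have "similar_mat (jordan_matrix n_as) (jordan_matrix ?J)"
      by (rule similar_mat_jordan_matrix_mset)
    then have "similar_mat A (jordan_matrix ?J)"
      using jnf similar_mat_trans unfolding jordan_nf_def by blast
    then show "A \<in> nilp_class \<mu>" by (simp add: nilp_class_def nilp_jordan_def)
  qed
  ultimately show ?thesis by simp
qed

section \<open>Matrices of the ideal as column families\<close>

text \<open>Row, column and letter indices start at 0, so index \<open>i\<close> stands for the tableau entry \<open>i + 1\<close>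
  and \<open>h (Suc j) \<le> i\<close> is \<open>hprec h (Suc j) (Suc i)\<close>.\<close>

definition nprec :: "nat \<Rightarrow> (nat \<Rightarrow> nat) \<Rightarrow> nat \<Rightarrow> nat" where
  "nprec n h i = card {j. j < n \<and> h (Suc j) \<le> i}"

text \<open>Since h is non-decreasing, the indices j with \<open>h (Suc j) \<le> i\<close> form an
  initial segment, and counting them gives its end.\<close>

lemma less_nprec_iff:
  assumes h: "hessenberg n h" and j: "j < n"
  shows "j < nprec n h i \<longleftrightarrow> h (Suc j) \<le> i"
proof -
  let ?S = "{j. j < n \<and> h (Suc j) \<le> i}"
  have down: "l \<in> ?S" if "l \<le> j'" "j' \<in> ?S" for l j'
  proof -
    have "h (Suc l) \<le> h (Suc j')"
      using h that by (auto simp: hessenberg_def intro: mono_onD)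
    then show ?thesis using that by simp
  qed
  show ?thesis
  proof
    assume "j < nprec n h i"
    show "h (Suc j) \<le> i"
    proof (rule ccontr)
      assume "\<not> h (Suc j) \<le> i"
      then have "?S \<subseteq> {..<j}" using down[of j] j by (metis (no_types, lifting) lessThan_iff mem_Collect_eq not_less subsetI)
      then have "card ?S \<le> j" using card_mono[of "{..<j}" ?S] by simp
      then show False using \<open>j < nprec n h i\<close> by (simp add: nprec_def)
    qed
  next
    assume "h (Suc j) \<le> i"
    then have "{..j} \<subseteq> ?S" using down[of _ j] j by blast
    then have "card {..j} \<le> card ?S" by (intro card_mono) simp_all
    then show "j < nprec n h i" by (simp add: nprec_def)
  qed
qed

text \<open>The bound comes from j + 1 \<le> h (j + 1) \<le> i.\<close>

lemma column_flag_nprec: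
  assumes h: "hessenberg n h" shows "column_flag (nprec n h)"
proof
  show "mono (nprec n h)"
    by (intro monoI, unfold nprec_def, rule card_mono) auto
  fix i
  have "Suc j \<le> h (Suc j)" if "j < n" for j using h that by (auto simp: hessenberg_def)
  then have "{j. j < n \<and> h (Suc j) \<le> i} \<subseteq> {..<i}" by (auto intro: Suc_le_lessD dest: order_trans)
  then show "nprec n h i \<le> i" using card_mono[of "{..<i}"] by (simp add: nprec_def)
qed

text \<open>The first index of the result is the column. Values outside the matrix are 0, as
  \<open>col_families\<close> demands.\<close>

definition mat_columns :: "nat \<Rightarrow> 'a::zero mat \<Rightarrow> nat \<Rightarrow> nat \<Rightarrow> 'a" where
  "mat_columns n A = (\<lambda>i j. if i < n \<and> j < n then A $$ (j, i) else 0)"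

lemma mult_mat_vec_columns:
  assumes A: "(A :: 'a::comm_ring_1 mat) \<in> carrier_mat n n"
  shows "A *\<^sub>v vec n x = vec n (colop n (mat_columns n A) x)"
proof (rule eq_vecI)
  show "(A *\<^sub>v vec n x) $ j = vec n (colop n (mat_columns n A) x) $ j"
    if "j < dim_vec (vec n (colop n (mat_columns n A) x))" for j
    using A that by (auto simp: colop_def mat_columns_def scalar_prod_def lessThan_atLeast0 mult.commute
        intro!: sum.cong)
qed (use A in simp)

lemma pow_mat_mult_vec_columns:
  assumes A: "(A :: 'a::comm_ring_1 mat) \<in> carrier_mat n n"
  shows "(A ^\<^sub>m r) *\<^sub>v vec n x = vec n ((colop n (mat_columns n A) ^^ r) x)"
proof (induction r arbitrary: x)
  case 0
  then show ?case using A by simp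
next
  case (Suc r)
  have "(A ^\<^sub>m Suc r) *\<^sub>v vec n x = (A ^\<^sub>m r) *\<^sub>v (A *\<^sub>v vec n x)"
    using A by (simp add: assoc_mult_mat_vec[of _ n n _ n])
  then show ?case unfolding mult_mat_vec_columns[OF A] Suc.IH by (simp add: funpow_Suc_right del: funpow.simps)
qed

context
  fixes n :: nat and h :: "nat \<Rightarrow> nat"
  assumes h: "hessenberg n h"
begin

interpretation column_flag n "nprec n h"
  using column_flag_nprec[OF h] .

text \<open>The entry in row j and column i, counted from 0, has to vanish iff i + 1 \<le> h (j +
  1), that is, iff \<open>nprec n h i \<le> j\<close>. So the condition on column i is membership in
  one flag subspace.\<close>

lemma bij_betw_mat_columns:
  "bij_betw (mat_columns n) (ad_nilp_ideal n h :: 'a::field mat set) (col_families n)"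
proof (rule bij_betw_byWitness[of _ "\<lambda>w. mat n n (\<lambda>(j, i). w i j)"])
  have npr: "nprec n h i \<le> j \<longleftrightarrow> Suc i \<le> h (Suc j)" if "j < n" for i j
    using less_nprec_iff[OF h that, of i] by auto
  have npn: "nprec n h i \<le> n" for i
    using card_mono[of "{..<n}" "{j. j < n \<and> h (Suc j) \<le> i}"] by (auto simp: nprec_def)
  show "\<forall>A\<in>ad_nilp_ideal n h :: 'a mat set. mat n n (\<lambda>(j, i). mat_columns n A i j) = A"
    by (auto simp: ad_nilp_ideal_def mat_columns_def intro!: eq_matI)
  show "\<forall>w\<in>col_families n :: (nat \<Rightarrow> nat \<Rightarrow> 'a) set. mat_columns n (mat n n (\<lambda>(j, i). w i j)) = w"
  proof
    fix w :: "nat \<Rightarrow> nat \<Rightarrow> 'a" assume w: "w \<in> col_families n"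
    have "w i j = 0" if "\<not> (i < n \<and> j < n)" for i j
    proof (cases "i < n")
      case True
      then show ?thesis using that w npn[of i] by (auto simp: col_families_def flag_def)
    qed (use w in \<open>simp add: col_families_def\<close>)
    then show "mat_columns n (mat n n (\<lambda>(j, i). w i j)) = w"
      by (auto simp: mat_columns_def fun_eq_iff)
  qed
  show "mat_columns n ` ad_nilp_ideal n h \<subseteq> (col_families n :: (nat \<Rightarrow> nat \<Rightarrow> 'a) set)"
  proof (rule image_subsetI)
    fix A :: "'a mat" assume A: "A \<in> ad_nilp_ideal n h"
    have "A $$ (j, i) = 0" if "j < n" "i < n" "nprec n h i \<le> j" for i j
    proof -
      have "Suc j \<in> {1..n}" "Suc i \<in> {1..n}" "Suc i \<le> h (Suc j)" using that npr by auto
      then have "A $$ (Suc j - 1, Suc i - 1) = 0" using A unfolding ad_nilp_ideal_def by blast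
      then show ?thesis by simp
    qed
    then show "mat_columns n A \<in> col_families n"
      by (auto simp: col_families_def mat_columns_def flag_def)
  qed
  show "(\<lambda>w. mat n n (\<lambda>(j, i). w i j)) ` col_families n \<subseteq> (ad_nilp_ideal n h :: 'a mat set)"
  proof (rule image_subsetI)
    fix w :: "nat \<Rightarrow> nat \<Rightarrow> 'a" assume w: "w \<in> col_families n"
    have "w (i - 1) (j - 1) = 0" if "j \<in> {1..n}" "i \<in> {1..n}" "i \<le> h j" for i j
    proof -
      have "j - 1 < n" using that by auto
      then have "nprec n h (i - 1) \<le> j - 1" using npr[of "j - 1" "i - 1"] that by simp
      then show ?thesis using w that by (auto simp: col_families_def flag_def)
    qed
    then show "mat n n (\<lambda>(j, i). w i j) \<in> ad_nilp_ideal n h"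
      by (auto simp: ad_nilp_ideal_def)
  qed
qed

text \<open>\<open>vec n\<close> identifies V_n with the vectors of dimension n, and powers of the
  operator stay inside V_n.\<close>

lemma card_mat_kernel_pow:
  assumes A: "(A :: 'a::{field,finite} mat) \<in> ad_nilp_ideal n h"
  shows "card (mat_kernel (A ^\<^sub>m r)) = card (ker_flag (mat_columns n A) n r)"
proof -
  let ?w = "mat_columns n A"
  have A': "A \<in> carrier_mat n n" using A by (simp add: ad_nilp_ideal_def)
  have w: "?w \<in> col_families n" using bij_betw_mat_columns[where 'a = 'a] A by (auto simp: bij_betw_def)
  have ker: "mat_kernel (A ^\<^sub>m r) = {v \<in> carrier_vec n. (A ^\<^sub>m r) *\<^sub>v v = 0\<^sub>v n}"
    using A' by (intro mat_kernel) simp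
  have "bij_betw (vec n) (ker_flag ?w n r) (mat_kernel (A ^\<^sub>m r))"
  proof (rule bij_betw_byWitness[of _ "\<lambda>v j. if j < n then v $ j else 0"])
    show "\<forall>x\<in>ker_flag ?w n r. (\<lambda>j. if j < n then vec n x $ j else 0) = x"
      by (auto simp: ker_flag_def flag_def fun_eq_iff)
    show "\<forall>v\<in>mat_kernel (A ^\<^sub>m r). vec n (\<lambda>j. if j < n then v $ j else 0) = v"
      unfolding ker by (auto intro!: eq_vecI)
    show "vec n ` ker_flag ?w n r \<subseteq> mat_kernel (A ^\<^sub>m r)"
      unfolding ker by (auto simp: ker_flag_def pow_mat_mult_vec_columns[OF A'] intro!: eq_vecI)
    show "(\<lambda>v j. if j < n then v $ j else 0) ` mat_kernel (A ^\<^sub>m r) \<subseteq> ker_flag ?w n r"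
    proof (rule image_subsetI)
      fix v assume v: "v \<in> mat_kernel (A ^\<^sub>m r)"
      define x where "x = (\<lambda>j. if j < n then v $ j else 0)"
      have x: "x \<in> flag n" by (simp add: x_def flag_def)
      have "v = vec n x" using v unfolding ker x_def by (auto intro!: eq_vecI)
      then have "(A ^\<^sub>m r) *\<^sub>v vec n x = 0\<^sub>v n" using v unfolding ker by simp
      then have 0: "vec n ((colop n ?w ^^ r) x) = 0\<^sub>v n" unfolding pow_mat_mult_vec_columns[OF A'] .
      have "(colop n ?w ^^ r) x j = 0" for j
      proof (cases "j < n")
        case True
        then show ?thesis using arg_cong[OF 0, of "\<lambda>v. v $ j"] by simp
      next
        case False
        then show ?thesis using colop_pow_flag[OF w x, of r] by (simp add: flag_def)
      qed
      then have "x \<in> ker_flag ?w n r" using x by (auto simp: ker_flag_def fun_eq_iff)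
      then show "(\<lambda>j. if j < n then v $ j else 0) \<in> ker_flag ?w n r" by (simp add: x_def)
    qed
  qed
  then show ?thesis by (metis bij_betw_same_card)
qed

end

section \<open>Row words and tableaux\<close>

lemma row_count_mono: "m \<le> m' \<Longrightarrow> row_count \<rho> m r \<le> row_count \<rho> m' r"
  unfolding row_count_def by (rule card_mono) auto

lemma row_count_less: "i < m \<Longrightarrow> row_count \<rho> i (\<rho> i) < row_count \<rho> m (\<rho> i)"
  using row_count_mono[of "Suc i" m \<rho> "\<rho> i"] by (simp add: row_count_Suc)

text \<open>Over the successive occurrences i of the letter r, \<open>row_count \<rho> i r\<close>
  takes the values 0, 1, 2, ..., so the first c occurrences are left out. These values are the
  columns of the boxes in row r.\<close>

lemma card_row_count_ge:
  "card {i. i < m \<and> \<rho> i = r \<and> c \<le> row_count \<rho> i r} = row_count \<rho> m r - c"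
proof (induction m)
  case (Suc m)
  have "{i. i < Suc m \<and> \<rho> i = r \<and> c \<le> row_count \<rho> i r} =
      {i. i < m \<and> \<rho> i = r \<and> c \<le> row_count \<rho> i r} \<union> (if \<rho> m = r \<and> c \<le> row_count \<rho> m r then {m} else {})"
    by (auto simp: less_Suc_eq)
  then show ?case using Suc by (simp add: card_insert_if row_count_Suc Suc_diff_le)
qed simp

lemma sum_row_count_eq_card: "(\<Sum>j<s. row_count \<rho> m j) = card {i. i < m \<and> \<rho> i < s}"
proof (induction s)
  case (Suc s)
  have "{i. i < m \<and> \<rho> i < Suc s} = {i. i < m \<and> \<rho> i < s} \<union> {i. i < m \<and> \<rho> i = s}" by auto
  then have "card {i. i < m \<and> \<rho> i < Suc s} = card {i. i < m \<and> \<rho> i < s} + card {i. i < m \<and> \<rho> i = s}"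
    by (simp add: card_Un_disjoint disjoint_iff)
  then show ?case using Suc by (simp add: row_count_def)
qed simp

lemma finite_boxes [simp]: "finite (boxes \<nu>)"
proof -
  have "boxes \<nu> = (SIGMA r:{..<length \<nu>}. {..<\<nu> ! r})" by (auto simp: boxes_def)
  then show ?thesis by simp
qed

lemma card_boxes: "card (boxes \<nu>) = sum_list \<nu>"
proof -
  have "boxes \<nu> = (SIGMA r:{..<length \<nu>}. {..<\<nu> ! r})" by (auto simp: boxes_def)
  then show ?thesis by (simp add: sum_list_sum_nth lessThan_atLeast0)
qed

lemma card_filter_bij_betw:
  assumes "bij_betw f A B" shows "card {b \<in> B. P b} = card {a \<in> A. P (f a)}"
proof -
  have "{b \<in> B. P b} = f ` {a \<in> A. P (f a)}" using assms by (auto simp: bij_betw_def)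
  moreover have "inj_on f {a \<in> A. P (f a)}"
    using assms by (auto simp: bij_betw_def intro: inj_on_subset)
  ultimately show ?thesis by (simp add: card_image)
qed

lemma prod_power_int: "q \<noteq> 0 \<Longrightarrow> (\<Prod>i\<in>A. (q::'b::field) powi f i) = q powi (\<Sum>i\<in>A. f i)"
  by (induction A rule: infinite_finite_induct) (simp_all add: power_int_add)

lemma card_boxes_rows_less: "card {b \<in> boxes \<nu>. fst b < r} = (\<Sum>j<r. card {b \<in> boxes \<nu>. fst b = j})"
proof (induction r)
  case (Suc r)
  have "{b \<in> boxes \<nu>. fst b < Suc r} = {b \<in> boxes \<nu>. fst b < r} \<union> {b \<in> boxes \<nu>. fst b = r}" by auto
  then have "card {b \<in> boxes \<nu>. fst b < Suc r} = card {b \<in> boxes \<nu>. fst b < r} + card {b \<in> boxes \<nu>. fst b = r}"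
    by (simp add: card_Un_disjoint disjoint_iff)
  then show ?case using Suc by simp
qed simp

section \<open>Lattice words and standard tableaux\<close>

text \<open>\<open>boxes_up\<close> expresses that the rows of \<nu> form a Young diagram, in the
  form in which a conjugate partition directly provides it.\<close>

locale young_words =
  fixes n :: nat and h :: "nat \<Rightarrow> nat" and \<nu> :: "nat list"
  assumes hess: "hessenberg n h" and sum_\<nu>: "sum_list \<nu> = n"
    and boxes_up: "(r, c) \<in> boxes \<nu> \<Longrightarrow> r' \<le> r \<Longrightarrow> (r', c) \<in> boxes \<nu>"
begin

text \<open>The words whose final row lengths are those of \<nu>, before any condition on the
  intermediate shapes.\<close>

definition words :: "(nat \<Rightarrow> nat) set" where
  "words = {\<rho> \<in> extensional {..<n}. \<forall>j. row_count \<rho> n j = card {b \<in> boxes \<nu>. fst b = j}}"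

text \<open>For the identity h this is the usual lattice (Yamanouchi) condition. In general the row
  above must already be long enough when only the letters before \<open>nprec n h i\<close> are
  counted, which is the condition for a non-zero \<open>step_factor\<close>.\<close>

definition lattice_words :: "(nat \<Rightarrow> nat) set" where
  "lattice_words = {\<rho> \<in> words.
     \<forall>i<n. 0 < \<rho> i \<longrightarrow> row_count \<rho> i (\<rho> i) < row_count \<rho> (nprec n h i) (\<rho> i - 1)}"

definition box_of :: "(nat \<Rightarrow> nat) \<Rightarrow> nat \<Rightarrow> box" where
  "box_of \<rho> i = (\<rho> i, row_count \<rho> i (\<rho> i))"

lemma fst_box_of [simp]: "fst (box_of \<rho> i) = \<rho> i"
  and snd_box_of [simp]: "snd (box_of \<rho> i) = row_count \<rho> i (\<rho> i)"
  by (simp_all add: box_of_def)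

definition tableau :: "(nat \<Rightarrow> nat) \<Rightarrow> box \<Rightarrow> nat" where
  "tableau \<rho> = (\<lambda>b\<in>boxes \<nu>. Suc (inv_into {..<n} (box_of \<rho>) b))"

definition word_of :: "(box \<Rightarrow> nat) \<Rightarrow> nat \<Rightarrow> nat" where
  "word_of T = (\<lambda>i\<in>{..<n}. fst (inv_into (boxes \<nu>) T (Suc i)))"

lemma boxes_left: "(r, c) \<in> boxes \<nu> \<Longrightarrow> c' \<le> c \<Longrightarrow> (r, c') \<in> boxes \<nu>"
  by (simp add: boxes_def)

lemma card_row: "card {b \<in> boxes \<nu>. fst b = r} = (if r < length \<nu> then \<nu> ! r else 0)"
proof -
  have "{b \<in> boxes \<nu>. fst b = r} = (if r < length \<nu> then Pair r ` {..<\<nu> ! r} else {})"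
    by (auto simp: boxes_def)
  then show ?thesis by (simp add: card_image inj_on_def)
qed

lemma row_word_less_length:
  assumes "\<rho> \<in> words" "i < n" shows "\<rho> i < length \<nu>"
  using row_count_less[OF assms(2), of \<rho>] assms(1) by (auto simp: words_def card_row split: if_splits)

lemma finite_words: "finite words"
proof -
  have "words \<subseteq> {..<n} \<rightarrow>\<^sub>E {..<length \<nu>}"
    using row_word_less_length by (auto simp: words_def PiE_def)
  then show ?thesis by (rule finite_subset) (simp add: finite_PiE)
qed

lemma bij_betw_box_of:
  assumes "\<rho> \<in> words" shows "bij_betw (box_of \<rho>) {..<n} (boxes \<nu>)"
proof -
  have inj: "inj_on (box_of \<rho>) {..<n}"
  proof (rule linorder_inj_onI)
    fix i j :: nat assume "i < j"
    then show "box_of \<rho> i \<noteq> box_of \<rho> j" using row_count_less[of i j \<rho>] by (auto simp: box_of_def)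
  qed auto
  have "box_of \<rho> ` {..<n} \<subseteq> boxes \<nu>"
  proof (rule image_subsetI)
    fix i assume i: "i \<in> {..<n}"
    then have len: "\<rho> i < length \<nu>" using row_word_less_length[OF assms] by simp
    then have "row_count \<rho> n (\<rho> i) = \<nu> ! \<rho> i" using assms by (simp add: words_def card_row)
    then show "box_of \<rho> i \<in> boxes \<nu>"
      using row_count_less[of i n \<rho>] len i by (simp add: boxes_def box_of_def)
  qed
  then have "box_of \<rho> ` {..<n} = boxes \<nu>"
    using card_image[OF inj] by (intro card_subset_eq) (simp_all add: card_boxes sum_\<nu>)
  with inj show ?thesis by (simp add: bij_betw_def)
qed

lemma tableau_box_of:
  assumes "\<rho> \<in> words" "i < n" shows "tableau \<rho> (box_of \<rho> i) = Suc i"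
  using bij_betw_box_of[OF assms(1)] assms(2)
  by (auto simp: tableau_def bij_betw_def)

lemma hprec_Suc_iff: "i < n \<Longrightarrow> hprec h (Suc i) (Suc i') \<longleftrightarrow> i < nprec n h i'"
  by (simp add: hprec_def less_nprec_iff[OF hess] less_Suc_eq_le)

text \<open>Rows increase because later letters extend a row further to the right. The lattice
  condition gives \<prec> between vertically adjacent boxes, and x \<le> h x makes this relation
  transitive and stronger than <.\<close>

lemma tableau_mem_SYT_h:
  assumes "\<rho> \<in> lattice_words" shows "tableau \<rho> \<in> SYT_h h \<nu>"
proof -
  let ?T = "tableau \<rho>"
  have \<rho>: "\<rho> \<in> words" using assms by (simp add: lattice_words_def)
  note bij = bij_betw_box_of[OF \<rho>]
  have Tb: "bij_betw ?T (boxes \<nu>) {1..n}"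
  proof -
    have "bij_betw Suc {..<n} {1..n}"
      by (rule bij_betw_byWitness[of _ "\<lambda>i. i - 1"]) auto
    then have "bij_betw (Suc \<circ> inv_into {..<n} (box_of \<rho>)) (boxes \<nu>) {1..n}"
      using bij_betw_inv_into[OF bij] by (rule bij_betw_trans[rotated])
    moreover have "bij_betw ?T (boxes \<nu>) {1..n} \<longleftrightarrow> bij_betw (Suc \<circ> inv_into {..<n} (box_of \<rho>)) (boxes \<nu>) {1..n}"
      by (rule bij_betw_cong) (simp add: tableau_def)
    ultimately show ?thesis by simp
  qed
  have obt: "\<exists>i<n. b = box_of \<rho> i \<and> ?T b = Suc i" if "b \<in> boxes \<nu>" for b
    using that bij tableau_box_of[OF \<rho>] unfolding bij_betw_def by (metis imageE lessThan_iff)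
  have row: "?T a < ?T b" if ab: "a \<in> boxes \<nu>" "b \<in> boxes \<nu>" "fst a = fst b" "snd a < snd b" for a b
  proof -
    obtain i j where ij: "i < n" "a = box_of \<rho> i" "?T a = Suc i" "j < n" "b = box_of \<rho> j" "?T b = Suc j"
      using obt[OF ab(1)] obt[OF ab(2)] by blast
    then show ?thesis
      using ab row_count_mono[of j i \<rho> "\<rho> i"] by (force simp: box_of_def not_less[symmetric])
  qed
  have adj: "hprec h (?T (r, c)) (?T (Suc r, c))" if rc: "(r, c) \<in> boxes \<nu>" "(Suc r, c) \<in> boxes \<nu>" for r c
  proof -
    obtain i j where ij: "i < n" "(r, c) = box_of \<rho> i" "?T (r, c) = Suc i"
        "j < n" "(Suc r, c) = box_of \<rho> j" "?T (Suc r, c) = Suc j"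
      using obt[OF rc(1)] obt[OF rc(2)] by blast
    have j: "\<rho> j = Suc r" and ij': "row_count \<rho> j (\<rho> j) = row_count \<rho> i r"
      using ij by (auto simp: box_of_def)
    have "0 < \<rho> j \<longrightarrow> row_count \<rho> j (\<rho> j) < row_count \<rho> (nprec n h j) (\<rho> j - 1)"
      using assms ij(4) unfolding lattice_words_def by blast
    then have "row_count \<rho> i r < row_count \<rho> (nprec n h j) r" using ij' by (simp add: j)
    then have "i < nprec n h j" using row_count_mono[of "nprec n h j" i \<rho> r] by linarith
    then show ?thesis using hprec_Suc_iff ij by simp
  qed
  have T_le: "?T b \<le> h (?T b)" if "b \<in> boxes \<nu>" for b
    using hess bij_betwE[OF Tb] that unfolding hessenberg_def by blast
  \<comment> \<open>Induction on the distance of the rows, with h x < y \<le> h y < z for three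
    entries x, y, z down the column.\<close>
  have col: "hprec h (?T (r, c)) (?T (Suc r + d, c))" if "(Suc r + d, c) \<in> boxes \<nu>" for r d c
    using that
  proof (induction d)
    case 0
    then show ?case using adj[of r c] boxes_up[of "Suc r" c r] by simp
  next
    case (Suc d)
    have b: "(Suc r + d, c) \<in> boxes \<nu>" using boxes_up[OF Suc.prems] by simp
    have "hprec h (?T (Suc r + d, c)) (?T (Suc (Suc r + d), c))" using adj[OF b] Suc.prems by simp
    then show ?case using Suc.IH[OF b] T_le[OF b] by (simp add: hprec_def)
  qed
  have col': "hprec h (?T a) (?T b)" if ab: "a \<in> boxes \<nu>" "b \<in> boxes \<nu>" "snd a = snd b" "fst a < fst b" for a b
  proof -
    have "Suc (fst a) + (fst b - Suc (fst a)) = fst b" using ab by simp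
    then have "hprec h (?T (fst a, snd b)) (?T b)"
      using col[of "fst a" "fst b - Suc (fst a)" "snd b"] ab(2) by simp
    then show ?thesis using ab(3) by (metis prod.collapse)
  qed
  have "?T a < ?T b" if ab: "a \<in> boxes \<nu>" "b \<in> boxes \<nu>" "snd a = snd b" "fst a < fst b" for a b
    using col'[OF ab] T_le[OF ab(1)] by (simp add: hprec_def)
  with Tb row col' show ?thesis by (auto simp: SYT_h_def SYT_def sum_\<nu> tableau_def[of \<rho>])
qed

text \<open>The boxes present after m steps are those with entries at most m.\<close>

lemma row_count_word_of:
  assumes bij: "bij_betw T (boxes \<nu>) {1..n}" and m: "m \<le> n"
  shows "row_count (word_of T) m r = card {b \<in> boxes \<nu>. fst b = r \<and> T b \<le> m}"
proof -
  note inv = bij_betw_inv_into_left[OF bij] bij_betw_inv_into_right[OF bij]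
  note invb = bij_betwE[OF bij_betw_inv_into[OF bij], rule_format]
  have "bij_betw (\<lambda>i. inv_into (boxes \<nu>) T (Suc i)) {i. i < m \<and> word_of T i = r}
      {b \<in> boxes \<nu>. fst b = r \<and> T b \<le> m}"
  proof (rule bij_betw_byWitness[of _ "\<lambda>b. T b - 1"])
    show "\<forall>i\<in>{i. i < m \<and> word_of T i = r}. T (inv_into (boxes \<nu>) T (Suc i)) - 1 = i"
      using inv(2) m by auto
    show "\<forall>b\<in>{b \<in> boxes \<nu>. fst b = r \<and> T b \<le> m}. inv_into (boxes \<nu>) T (Suc (T b - 1)) = b"
      using inv(1) bij_betwE[OF bij] by fastforce
    show "(\<lambda>i. inv_into (boxes \<nu>) T (Suc i)) ` {i. i < m \<and> word_of T i = r} \<subseteq>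
        {b \<in> boxes \<nu>. fst b = r \<and> T b \<le> m}"
      using inv(2) invb m by (auto simp: word_of_def)
    show "(\<lambda>b. T b - 1) ` {b \<in> boxes \<nu>. fst b = r \<and> T b \<le> m} \<subseteq> {i. i < m \<and> word_of T i = r}"
    proof (rule image_subsetI)
      fix b assume b: "b \<in> {b \<in> boxes \<nu>. fst b = r \<and> T b \<le> m}"
      then have "T b \<in> {1..n}" using bij_betwE[OF bij] by blast
      then have "Suc (T b - 1) = T b" "T b - 1 < m" using b by auto
      then show "T b - 1 \<in> {i. i < m \<and> word_of T i = r}" using b m inv(1) by (simp add: word_of_def)
    qed
  qed
  then show ?thesis unfolding row_count_def by (rule bij_betw_same_card)
qed

text \<open>Entries increase along rows, so in the row of the box with entry i + 1 the entries at
  most i are those to its left; their number is its column.\<close>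

lemma box_of_word_of:
  assumes T: "T \<in> SYT \<nu>" and i: "i < n"
  shows "box_of (word_of T) i = inv_into (boxes \<nu>) T (Suc i)"
proof -
  have bij: "bij_betw T (boxes \<nu>) {1..n}" using T by (simp add: SYT_def sum_\<nu>)
  obtain r c where rc: "inv_into (boxes \<nu>) T (Suc i) = (r, c)" by fastforce
  have b: "(r, c) \<in> boxes \<nu>" using bij_betwE[OF bij_betw_inv_into[OF bij]] i rc[symmetric] by simp
  have Trc: "T (r, c) = Suc i" using bij_betw_inv_into_right[OF bij, of "Suc i"] i rc by simp
  have row: "T (r, c1) < T (r, c2)" if "c1 < c2" "(r, c2) \<in> boxes \<nu>" for c1 c2
    using T that boxes_left[OF that(2), of c1] by (auto simp: SYT_def)
  have "{b \<in> boxes \<nu>. fst b = r \<and> T b \<le> i} = Pair r ` {..<c}"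
  proof (intro equalityI subsetI)
    fix a assume a: "a \<in> {b \<in> boxes \<nu>. fst b = r \<and> T b \<le> i}"
    then obtain c' where c': "a = (r, c')" by (cases a) auto
    have "c' < c"
    proof (rule ccontr)
      assume "\<not> c' < c"
      then have "T (r, c) \<le> T (r, c')" using row[of c c'] a c' by (cases "c = c'") auto
      then show False using a c' Trc by simp
    qed
    then show "a \<in> Pair r ` {..<c}" using c' by simp
  qed (use row[OF _ b] boxes_left[OF b] Trc in \<open>auto simp: less_Suc_eq_le\<close>)
  then have "row_count (word_of T) i r = c"
    using row_count_word_of[OF bij, of i r] i by (simp add: card_image inj_on_def)
  then show ?thesis using rc i by (simp add: box_of_def word_of_def)
qed

text \<open>If i + 1 stands in box (r + 1, c), the entry above it precedes i + 1 and is at most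
  \<open>nprec n h i\<close>, as are all entries further left in row r. So row r has at least c + 1
  letters before \<open>nprec n h i\<close>.\<close>

lemma word_of_mem_lattice_words:
  assumes T: "T \<in> SYT_h h \<nu>" shows "word_of T \<in> lattice_words"
proof -
  have T': "T \<in> SYT \<nu>" using T by (simp add: SYT_h_def)
  have bij: "bij_betw T (boxes \<nu>) {1..n}" using T' by (simp add: SYT_def sum_\<nu>)
  have Tn: "T b \<in> {1..n}" if "b \<in> boxes \<nu>" for b using bij_betwE[OF bij] that by blast
  have "{b \<in> boxes \<nu>. fst b = j \<and> T b \<le> n} = {b \<in> boxes \<nu>. fst b = j}" for j
    using Tn by auto
  then have words: "word_of T \<in> words"
    using row_count_word_of[OF bij order_refl] by (simp add: words_def word_of_def)
  have "row_count (word_of T) i (word_of T i) < row_count (word_of T) (nprec n h i) (word_of T i - 1)"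
    if i: "i < n" "0 < word_of T i" for i
  proof -
    obtain r c where rc: "box_of (word_of T) i = (Suc r, c)"
      using i(2) by (cases "word_of T i") (auto simp: box_of_def)
    then have inv: "inv_into (boxes \<nu>) T (Suc i) = (Suc r, c)" using box_of_word_of[OF T' i(1)] by simp
    have b: "(Suc r, c) \<in> boxes \<nu>" using bij_betwE[OF bij_betw_inv_into[OF bij]] i inv[symmetric] by simp
    have b': "(r, c) \<in> boxes \<nu>" using boxes_up[OF b] by simp
    have Trc: "T (Suc r, c) = Suc i" using bij_betw_inv_into_right[OF bij, of "Suc i"] i inv by simp
    have "hprec h (T (r, c)) (Suc i)" using T b b' Trc unfolding SYT_h_def by force
    moreover have "Suc (T (r, c) - 1) = T (r, c)" "T (r, c) - 1 < n" using Tn[OF b'] by auto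
    ultimately have le: "T (r, c) \<le> nprec n h i" using hprec_Suc_iff[of "T (r, c) - 1" i] by simp
    have "T (r, c') \<le> T (r, c)" if "c' \<le> c" for c'
      using T' b' that boxes_left[OF b' that] unfolding SYT_def by (cases "c' = c") (force simp: less_imp_le)+
    then have "Pair r ` {..c} \<subseteq> {b \<in> boxes \<nu>. fst b = r \<and> T b \<le> nprec n h i}"
      using boxes_left[OF b'] le by (auto intro: order_trans)
    then have "card (Pair r ` {..c}) \<le> card {b \<in> boxes \<nu>. fst b = r \<and> T b \<le> nprec n h i}"
      by (rule card_mono[rotated]) simp
    moreover have "nprec n h i \<le> n"
      using column_flag.k_le[OF column_flag_nprec[OF hess], of i] i by simp
    ultimately have "c < row_count (word_of T) (nprec n h i) r"
      using row_count_word_of[OF bij] by (simp add: card_image inj_on_def)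
    then show ?thesis using rc by (auto simp: box_of_def)
  qed
  then show ?thesis using words by (simp add: lattice_words_def)
qed

lemma bij_betw_tableau: "bij_betw tableau lattice_words (SYT_h h \<nu>)"
proof (rule bij_betw_byWitness[of _ word_of])
  show "\<forall>\<rho>\<in>lattice_words. word_of (tableau \<rho>) = \<rho>"
  proof
    fix \<rho> assume \<rho>: "\<rho> \<in> lattice_words"
    then have w: "\<rho> \<in> words" by (simp add: lattice_words_def)
    have bij: "bij_betw (tableau \<rho>) (boxes \<nu>) {1..n}"
      using tableau_mem_SYT_h[OF \<rho>] by (simp add: SYT_h_def SYT_def sum_\<nu>)
    have "inv_into (boxes \<nu>) (tableau \<rho>) (Suc i) = box_of \<rho> i" if "i < n" for i
      using bij_betw_inv_into_left[OF bij, of "box_of \<rho> i"] tableau_box_of[OF w that]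
        bij_betwE[OF bij_betw_box_of[OF w]] that by simp
    then have "word_of (tableau \<rho>) i = \<rho> i" for i
      using w by (auto simp: word_of_def box_of_def words_def extensional_def)
    then show "word_of (tableau \<rho>) = \<rho>" ..
  qed
  show "\<forall>T\<in>SYT_h h \<nu>. tableau (word_of T) = T"
  proof
    fix T assume T: "T \<in> SYT_h h \<nu>"
    then have T': "T \<in> SYT \<nu>" by (simp add: SYT_h_def)
    have bij: "bij_betw T (boxes \<nu>) {1..n}" using T' by (simp add: SYT_def sum_\<nu>)
    have w: "word_of T \<in> words" using word_of_mem_lattice_words[OF T] by (simp add: lattice_words_def)
    have "tableau (word_of T) b = T b" if b: "b \<in> boxes \<nu>" for b
    proof -
      have "T b \<in> {1..n}" using bij_betwE[OF bij] b by blast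
      then have i: "Suc (T b - 1) = T b" "T b - 1 < n" by auto
      then have "box_of (word_of T) (T b - 1) = b"
        using box_of_word_of[OF T' i(2)] bij_betw_inv_into_left[OF bij b] by simp
      then show ?thesis using tableau_box_of[OF w i(2)] i(1) by simp
    qed
    moreover have ext: "T \<in> extensional (boxes \<nu>)" using T' unfolding SYT_def by blast
    have "tableau (word_of T) b = T b" if "b \<notin> boxes \<nu>" for b
      using that extensional_arb[OF ext that] by (simp add: tableau_def)
    ultimately show "tableau (word_of T) = T" by blast
  qed
qed (use tableau_mem_SYT_h word_of_mem_lattice_words in auto)

section \<open>Tableau statistics and step factors\<close>

sublocale column_flag n "nprec n h"
  using column_flag_nprec[OF hess] .

lemma coleg_eq: "b \<in> boxes \<nu> \<Longrightarrow> coleg \<nu> b = fst b"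
proof -
  assume b: "b \<in> boxes \<nu>"
  have "{c \<in> boxes \<nu>. snd c = snd b \<and> fst c < fst b} = (\<lambda>r. (r, snd b)) ` {..<fst b}"
    using boxes_up[of "fst b" "snd b"] b by auto
  then show ?thesis by (simp add: coleg_def card_image inj_on_def)
qed

lemma boxes_coleg: "{b \<in> boxes \<nu>. 1 \<le> coleg \<nu> b} = {b \<in> boxes \<nu>. 1 \<le> fst b}"
  using coleg_eq by auto

lemma hprec_tableau_box_of:
  assumes "\<rho> \<in> words" "j < n"
  shows "hprec h (tableau \<rho> (box_of \<rho> j)) (Suc i) \<longleftrightarrow> j < nprec n h i"
  using tableau_box_of[OF assms] hprec_Suc_iff[OF assms(2)] by simp

text \<open>The boxes counted come from the positions j with \<open>nprec n h i\<close> \<le> j < i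
  and a smaller letter, a difference of two initial segments. The same two sums occur in
  \<open>reach_exp\<close>.\<close>

lemma gamma_box_box_of:
  assumes \<rho>: "\<rho> \<in> words" and i: "i < n"
  shows "int (gamma_box h \<nu> (tableau \<rho>) (box_of \<rho> i)) =
    (\<Sum>l<\<rho> i. int (row_count \<rho> i l)) - (\<Sum>l<\<rho> i. int (row_count \<rho> (nprec n h i) l))"
proof -
  let ?C = "\<lambda>m. {j. j < m \<and> \<rho> j < \<rho> i}"
  have b: "box_of \<rho> i \<in> boxes \<nu>" using bij_betwE[OF bij_betw_box_of[OF \<rho>]] i by simp
  have "gamma_box h \<nu> (tableau \<rho>) (box_of \<rho> i) = card {c \<in> boxes \<nu>. fst c < \<rho> i \<and>
      tableau \<rho> c < Suc i \<and> \<not> hprec h (tableau \<rho> c) (Suc i)}"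
    using coleg_eq[OF b] tableau_box_of[OF \<rho> i] by (simp add: gamma_box_def)
  then have "gamma_box h \<nu> (tableau \<rho>) (box_of \<rho> i) = card {j \<in> {..<n}. fst (box_of \<rho> j) < \<rho> i \<and>
      tableau \<rho> (box_of \<rho> j) < Suc i \<and> \<not> hprec h (tableau \<rho> (box_of \<rho> j)) (Suc i)}"
    unfolding card_filter_bij_betw[OF bij_betw_box_of[OF \<rho>]] .
  moreover have "{j \<in> {..<n}. fst (box_of \<rho> j) < \<rho> i \<and> tableau \<rho> (box_of \<rho> j) < Suc i \<and>
      \<not> hprec h (tableau \<rho> (box_of \<rho> j)) (Suc i)} = ?C i - ?C (nprec n h i)"
    using i tableau_box_of[OF \<rho>] hprec_tableau_box_of[OF \<rho>] by auto
  moreover have "?C (nprec n h i) \<subseteq> ?C i" using k_le[of i] by auto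
  then have "int (card (?C i - ?C (nprec n h i))) = int (card (?C i)) - int (card (?C (nprec n h i)))"
    by (simp add: card_Diff_subset of_nat_diff card_mono)
  ultimately show ?thesis by (simp only: sum_row_count_eq_card[symmetric] of_nat_sum)
qed

text \<open>The boxes counted are the occurrences of the letter \<open>\<rho> i - 1\<close> before
  \<open>nprec n h i\<close> whose column exceeds that of box i. For a lattice word and
  \<open>0 < \<rho> i\<close>, the arm plus one is therefore the exponent of 1/q in
  \<open>step_factor\<close>.\<close>

lemma arm_h_box_of:
  assumes \<rho>: "\<rho> \<in> words" and i: "i < n"
  shows "arm_h h \<nu> (tableau \<rho>) (up (box_of \<rho> i)) (tableau \<rho> (box_of \<rho> i)) =
    row_count \<rho> (nprec n h i) (\<rho> i - 1) - Suc (row_count \<rho> i (\<rho> i))"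
proof -
  have kn: "nprec n h i < n" using k_le[of i] i by simp
  have "arm_h h \<nu> (tableau \<rho>) (up (box_of \<rho> i)) (tableau \<rho> (box_of \<rho> i)) =
      card {c \<in> boxes \<nu>. fst c = \<rho> i - 1 \<and> row_count \<rho> i (\<rho> i) < snd c \<and> hprec h (tableau \<rho> c) (Suc i)}"
    using tableau_box_of[OF \<rho> i] by (simp add: arm_h_def up_def)
  then have "arm_h h \<nu> (tableau \<rho>) (up (box_of \<rho> i)) (tableau \<rho> (box_of \<rho> i)) =
      card {j \<in> {..<n}. fst (box_of \<rho> j) = \<rho> i - 1 \<and> row_count \<rho> i (\<rho> i) < snd (box_of \<rho> j) \<and>
        hprec h (tableau \<rho> (box_of \<rho> j)) (Suc i)}"
    unfolding card_filter_bij_betw[OF bij_betw_box_of[OF \<rho>]] .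
  moreover have "{j \<in> {..<n}. fst (box_of \<rho> j) = \<rho> i - 1 \<and> row_count \<rho> i (\<rho> i) < snd (box_of \<rho> j) \<and>
      hprec h (tableau \<rho> (box_of \<rho> j)) (Suc i)} =
      {j. j < nprec n h i \<and> \<rho> j = \<rho> i - 1 \<and> Suc (row_count \<rho> i (\<rho> i)) \<le> row_count \<rho> j (\<rho> i - 1)}"
    using kn hprec_tableau_box_of[OF \<rho>] by (auto simp: Suc_le_eq)
  ultimately show ?thesis by (simp only: card_row_count_ge)
qed

text \<open>The exponent at position i is i minus the column of its box minus its
  \<open>gamma_box\<close>. For d = arm + 1, the factor 1 - q^(-d) is (q - 1)/q times the q-integer
  of d at 1/q, which yields one power of (q - 1)/q for each box of \<open>B\<close>.\<close>

lemma prod_step_factor: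
  fixes q :: real
  assumes \<rho>: "\<rho> \<in> lattice_words" and q: "q \<noteq> 0" "q \<noteq> 1"
  defines "B \<equiv> {b \<in> boxes \<nu>. 1 \<le> coleg \<nu> b}"
  shows "(\<Prod>i<n. step_factor q \<rho> i) =
    q powi (int (n choose 2) - int (\<Sum>b\<in>boxes \<nu>. snd b) - int (card B)) * (q - 1) ^ card B *
    ((1 / q) ^ gamma h \<nu> (tableau \<rho>) *
      (\<Prod>b\<in>B. q_int (1 / q) (arm_h h \<nu> (tableau \<rho>) (up b) (tableau \<rho> b) + 1)))"
proof -
  let ?T = "tableau \<rho>"
  define a where "a b = q_int (1 / q) (arm_h h \<nu> ?T (up b) (?T b) + 1)" for b
  have w: "\<rho> \<in> words" using \<rho> by (simp add: lattice_words_def)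
  note bij = bij_betw_box_of[OF w]
  have sf: "step_factor q \<rho> i = q powi reach_exp \<rho> i (\<rho> i) *
      (if 1 \<le> fst (box_of \<rho> i) then (q - 1) / q * a (box_of \<rho> i) else 1)" if i: "i < n" for i
  proof (cases "\<rho> i = 0")
    case False
    let ?d = "row_count \<rho> (nprec n h i) (\<rho> i - 1) - row_count \<rho> i (\<rho> i)"
    have lat: "row_count \<rho> i (\<rho> i) < row_count \<rho> (nprec n h i) (\<rho> i - 1)"
      using \<rho> i False unfolding lattice_words_def by blast
    have "a (box_of \<rho> i) = q_int (1 / q) ?d"
      unfolding a_def arm_h_box_of[OF w i] using lat by (simp add: Suc_diff_Suc)
    moreover have "(q - 1) / q * q_int (1 / q) ?d = 1 - (1 / q) ^ ?d"
      using q by (simp add: q_int_def divide_simps) (simp add: algebra_simps)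
    ultimately show ?thesis using lat False by (simp add: step_factor_def box_of_def)
  qed (simp add: step_factor_def box_of_def)
  have "(\<Prod>i<n. step_factor q \<rho> i) = (\<Prod>i<n. q powi reach_exp \<rho> i (\<rho> i)) *
      (\<Prod>i<n. if 1 \<le> fst (box_of \<rho> i) then (q - 1) / q * a (box_of \<rho> i) else 1)"
    by (simp add: sf prod.distrib)
  also have "(\<Prod>i<n. if 1 \<le> fst (box_of \<rho> i) then (q - 1) / q * a (box_of \<rho> i) else 1) =
      (\<Prod>b\<in>boxes \<nu>. if 1 \<le> fst b then (q - 1) / q * a b else 1)"
    by (rule prod.reindex_bij_betw[OF bij])
  also have "\<dots> = (\<Prod>b\<in>B. (q - 1) / q * a b)"
    unfolding B_def boxes_coleg by (rule prod.inter_filter[symmetric]) simp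
  also have "\<dots> = ((q - 1) / q) ^ card B * (\<Prod>b\<in>B. a b)" by (simp only: prod.distrib prod_constant)
  also have "(\<Prod>i<n. q powi reach_exp \<rho> i (\<rho> i)) = q powi (\<Sum>i<n. reach_exp \<rho> i (\<rho> i))"
    using q(1) by (rule prod_power_int)
  also have "(\<Sum>i<n. reach_exp \<rho> i (\<rho> i)) =
      (\<Sum>i<n. int i - int (snd (box_of \<rho> i)) - int (gamma_box h \<nu> ?T (box_of \<rho> i)))"
    using gamma_box_box_of[OF w] by (intro sum.cong refl) (simp add: reach_exp_def box_of_def)
  also have "\<dots> = (\<Sum>i<n. int i) - (\<Sum>i<n. int (snd (box_of \<rho> i))) -
      (\<Sum>i<n. int (gamma_box h \<nu> ?T (box_of \<rho> i)))"
    by (simp add: sum_subtractf)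
  also have "(\<Sum>i<n. int (snd (box_of \<rho> i))) = (\<Sum>b\<in>boxes \<nu>. int (snd b))"
    by (rule sum.reindex_bij_betw[OF bij])
  also have "(\<Sum>i<n. int (gamma_box h \<nu> ?T (box_of \<rho> i))) = (\<Sum>b\<in>boxes \<nu>. int (gamma_box h \<nu> ?T b))"
    by (rule sum.reindex_bij_betw[OF bij])
  \<comment> \<open>The top row, left out in \<open>gamma\<close>, has \<open>gamma_box\<close>
    equal to 0.\<close>
  also have "\<dots> = int (gamma h \<nu> ?T)"
    unfolding gamma_def of_nat_sum by (rule sum.mono_neutral_right) (auto simp: gamma_box_def)
  also have "(\<Sum>i<n. int i) = int (n choose 2)"
    using gauss_sum_nat[of "n - 1"]
    by (cases n) (simp_all add: choose_two atLeast0AtMost lessThan_Suc_atMost of_nat_sum[symmetric] mult.commute del: of_nat_sum)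
  finally have "(\<Prod>i<n. step_factor q \<rho> i) =
      q powi (int (n choose 2) - (\<Sum>b\<in>boxes \<nu>. int (snd b)) - int (gamma h \<nu> ?T)) *
      (((q - 1) / q) ^ card B * (\<Prod>b\<in>B. a b))" .
  \<comment> \<open>With c = \<open>card B\<close>, the factor q^c cancels the denominator of ((q -
    1)/q)^c.\<close>
  moreover have "q powi (x - int g) = q powi (x - int c) * q ^ c * (1 / q) ^ g" for x g c
    using q(1) by (simp add: power_int_diff power_divide)
  note this[of _ "gamma h \<nu> ?T" "card B"]
  ultimately show ?thesis
    using q(1) by (simp add: a_def power_divide del: of_nat_sum) simp
qed

text \<open>A word that violates the lattice condition has a vanishing step factor; the remaining
  words are the tableaux.\<close>

lemma sum_prod_step_factor:
  fixes q :: real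
  assumes q: "q \<noteq> 0" "q \<noteq> 1"
  defines "B \<equiv> {b \<in> boxes \<nu>. 1 \<le> coleg \<nu> b}"
  shows "(\<Sum>\<rho>\<in>words. \<Prod>i<n. step_factor q \<rho> i) =
    q powi (int (n choose 2) - int (\<Sum>b\<in>boxes \<nu>. snd b) - int (card B)) * (q - 1) ^ card B *
    F_under \<nu> h (1 / q)"
proof -
  have "(\<Prod>i<n. step_factor q \<rho> i) = 0" if \<rho>: "\<rho> \<in> words - lattice_words" for \<rho>
  proof -
    obtain i where i: "i < n" "0 < \<rho> i" "\<not> row_count \<rho> i (\<rho> i) < row_count \<rho> (nprec n h i) (\<rho> i - 1)"
      using \<rho> unfolding lattice_words_def by blast
    then have "step_factor q \<rho> i = 0" by (simp add: step_factor_def)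
    with i(1) show ?thesis by (meson finite_lessThan lessThan_iff prod_zero)
  qed
  then have "(\<Sum>\<rho>\<in>words. \<Prod>i<n. step_factor q \<rho> i) = (\<Sum>\<rho>\<in>lattice_words. \<Prod>i<n. step_factor q \<rho> i)"
    using finite_words by (intro sum.mono_neutral_right) (auto simp: lattice_words_def)
  also have "\<dots> = (\<Sum>\<rho>\<in>lattice_words.
      q powi (int (n choose 2) - int (\<Sum>b\<in>boxes \<nu>. snd b) - int (card B)) * (q - 1) ^ card B *
      ((1 / q) ^ gamma h \<nu> (tableau \<rho>) *
        (\<Prod>b\<in>B. q_int (1 / q) (arm_h h \<nu> (tableau \<rho>) (up b) (tableau \<rho> b) + 1))))"
    unfolding B_def using q by (intro sum.cong refl prod_step_factor)
  also have "\<dots> = (\<Sum>T\<in>SYT_h h \<nu>.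
      q powi (int (n choose 2) - int (\<Sum>b\<in>boxes \<nu>. snd b) - int (card B)) * (q - 1) ^ card B *
      ((1 / q) ^ gamma h \<nu> T * (\<Prod>b\<in>B. q_int (1 / q) (arm_h h \<nu> T (up b) (T b) + 1))))"
    by (rule sum.reindex_bij_betw[OF bij_betw_tableau])
  finally show ?thesis unfolding F_under_def B_def by (simp add: sum_distrib_left)
qed

section \<open>From kernel dimensions to row words\<close>

text \<open>Differences of consecutive kernel dimensions recover the row lengths, so the Jordan type
  of the whole matrix is a condition on the content of its word.\<close>

lemma card_ker_flag_words:
  fixes w :: "nat \<Rightarrow> nat \<Rightarrow> 'a::{field,finite}"
  assumes w: "w \<in> col_families n"
  shows "(\<forall>r. card (ker_flag w n r) = CARD('a) ^ card {b \<in> boxes \<nu>. fst b < r}) \<longleftrightarrow>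
    restrict (row_of w) {..<n} \<in> words"
proof -
  let ?c = "\<lambda>j. row_count (row_of w) n j" and ?d = "\<lambda>j. card {b \<in> boxes \<nu>. fst b = j}"
  have rc: "row_count (restrict (row_of w) {..<n}) n j = ?c j" for j
    by (rule row_count_cong) simp
  have "(\<forall>r. card (ker_flag w n r) = CARD('a) ^ card {b \<in> boxes \<nu>. fst b < r}) \<longleftrightarrow>
      (\<forall>r. (\<Sum>j<r. ?c j) = (\<Sum>j<r. ?d j))"
    unfolding card_ker_flag[OF w order_refl order_refl] card_boxes_rows_less
    using card_field_gt_1[where 'a = 'a] by simp
  also have "\<dots> \<longleftrightarrow> (\<forall>j. ?c j = ?d j)"
  proof
    assume eq: "\<forall>r. (\<Sum>j<r. ?c j) = (\<Sum>j<r. ?d j)"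
    show "\<forall>j. ?c j = ?d j"
    proof
      fix j show "?c j = ?d j" using eq[rule_format, of j] eq[rule_format, of "Suc j"] by simp
    qed
  qed simp
  finally show ?thesis by (simp add: words_def rc)
qed

text \<open>Each family has exactly one row word, so the families in question split into the
  disjoint sets \<open>word_families n \<rho>\<close>.\<close>

lemma card_class_families:
  "real (card {w \<in> col_families n :: (nat \<Rightarrow> nat \<Rightarrow> 'a::{field,finite}) set. \<forall>r. card (ker_flag w n r) = CARD('a) ^ card {b \<in> boxes \<nu>. fst b < r}}) =
    (\<Sum>\<rho>\<in>words. \<Prod>i<n. step_factor (real CARD('a)) \<rho> i)"
    (is "real (card ?S) = _")
proof -
  have "?S = {w \<in> col_families n. restrict (row_of w) {..<n} \<in> words}"
    using card_ker_flag_words by blast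
  also have "\<dots> = (\<Union>\<rho>\<in>words. word_families n \<rho>)"
  proof (intro equalityI subsetI)
    fix w :: "nat \<Rightarrow> nat \<Rightarrow> 'a"
    assume "w \<in> {w \<in> col_families n. restrict (row_of w) {..<n} \<in> words}"
    moreover from this have "w \<in> word_families n (restrict (row_of w) {..<n})"
      by (simp add: word_families_def)
    ultimately show "w \<in> (\<Union>\<rho>\<in>words. word_families n \<rho>)" by blast
  next
    fix w :: "nat \<Rightarrow> nat \<Rightarrow> 'a" assume "w \<in> (\<Union>\<rho>\<in>words. word_families n \<rho>)"
    then obtain \<rho> where \<rho>: "\<rho> \<in> words" "w \<in> word_families n \<rho>" by blast
    then have "restrict (row_of w) {..<n} i = \<rho> i" for i
      by (auto simp: word_families_def words_def extensional_def)
    then have "restrict (row_of w) {..<n} = \<rho>" ..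
    with \<rho> show "w \<in> {w \<in> col_families n. restrict (row_of w) {..<n} \<in> words}"
      by (simp add: word_families_def)
  qed
  finally have S: "?S = (\<Union>\<rho>\<in>words. word_families n \<rho>)" .
  have "card (\<Union>\<rho>\<in>words. word_families n \<rho> :: (nat \<Rightarrow> nat \<Rightarrow> 'a) set) = (\<Sum>\<rho>\<in>words. card (word_families n \<rho> :: (nat \<Rightarrow> nat \<Rightarrow> 'a) set))"
  proof (rule card_UN_disjoint[OF finite_words])
    show "\<forall>\<rho>\<in>words. finite (word_families n \<rho> :: (nat \<Rightarrow> nat \<Rightarrow> 'a) set)"
      using finite_card_word_families by blast
    show "\<forall>\<rho>\<in>words. \<forall>\<sigma>\<in>words. \<rho> \<noteq> \<sigma> \<longrightarrow>
        (word_families n \<rho> :: (nat \<Rightarrow> nat \<Rightarrow> 'a) set) \<inter> word_families n \<sigma> = {}"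
    proof (intro ballI impI)
      fix \<rho> \<sigma> assume "\<rho> \<in> words" "\<sigma> \<in> words" "\<rho> \<noteq> \<sigma>"
      then obtain i where "i < n" "\<rho> i \<noteq> \<sigma> i"
        using extensionalityI[of \<rho> "{..<n}" \<sigma>] by (auto simp: words_def)
      then show "(word_families n \<rho> :: (nat \<Rightarrow> nat \<Rightarrow> 'a) set) \<inter> word_families n \<sigma> = {}"
        by (auto simp: word_families_def)
    qed
  qed
  then show ?thesis unfolding S using finite_card_word_families[OF order_refl, where 'a = 'a] by simp
qed

end

section \<open>The conjugate partition and the count of the nilpotent class\<close>

text \<open>The parts weakly decrease, so the rows of \<mu> longer than r form an initial segment;
  their number exceeds c iff row c is one of them.\<close>

lemma mem_boxes_conj_part:
  assumes "is_partition n \<mu>" shows "(r, c) \<in> boxes (conj_part \<mu>) \<longleftrightarrow> (c, r) \<in> boxes \<mu>"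
proof (cases \<mu>)
  case Nil
  then show ?thesis by (simp add: conj_part_def boxes_def)
next
  case (Cons m ms)
  have anti: "\<mu> ! j \<le> \<mu> ! i" if "i \<le> j" "j < length \<mu>" for i j
    using assms that sorted_wrt_nth_less[of "(\<ge>)" \<mu> i j] by (cases "i = j") (auto simp: is_partition_def)
  have "c < card {i. i < length \<mu> \<and> r < \<mu> ! i} \<longleftrightarrow> c < length \<mu> \<and> r < \<mu> ! c" (is "c < card ?S \<longleftrightarrow> ?R")
  proof
    assume c: "c < card ?S"
    show ?R
    proof (rule ccontr)
      assume "\<not> ?R"
      have "?S \<subseteq> {..<c}"
      proof
        fix i assume i: "i \<in> ?S"
        show "i \<in> {..<c}"
        proof (rule ccontr)
          assume "i \<notin> {..<c}"
          then have "\<mu> ! i \<le> \<mu> ! c" using anti[of c i] i by simp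
          then show False using \<open>\<not> ?R\<close> \<open>i \<notin> {..<c}\<close> i by simp
        qed
      qed
      then have "card ?S \<le> c" using card_mono[of "{..<c}" ?S] by simp
      with c show False by simp
    qed
  next
    assume ?R
    then have "{..c} \<subseteq> ?S" using anti[of _ c] by (auto intro: less_le_trans le_less_trans)
    then have "card {..c} \<le> card ?S" by (intro card_mono) auto
    then show "c < card ?S" by simp
  qed
  moreover have "r < m" if "c < length \<mu>" "r < \<mu> ! c"
    using anti[of 0 c] that Cons by simp
  ultimately show ?thesis using Cons by (auto simp: conj_part_def boxes_def)
qed

lemma bij_betw_boxes_conj_part:
  assumes "is_partition n \<mu>" shows "bij_betw prod.swap (boxes \<mu>) (boxes (conj_part \<mu>))"
  by (rule bij_betw_byWitness[of _ prod.swap]) (auto simp: mem_boxes_conj_part[OF assms])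

theorem theorem1p6:
  fixes n q :: nat and h :: "nat \<Rightarrow> nat" and \<mu> :: "nat list"
  assumes "hessenberg n h"
    and "is_partition n \<mu>"
    and "q = CARD('a::{field,finite})"
  shows "real (F_count TYPE('a) n \<mu> h) =
    real q powi (int (n choose 2) - int (n_stat \<mu>) - (int n - int (length \<mu>))) *
    (real q - 1) ^ (n - length \<mu>) * F_under (conj_part \<mu>) h (1 / real q)"
proof -
  let ?\<nu> = "conj_part \<mu>"
  note swap = bij_betw_boxes_conj_part[OF assms(2)]
  have card_\<mu>: "card (boxes \<mu>) = n" using assms(2) by (simp add: card_boxes is_partition_def)
  have card_\<nu>: "card (boxes ?\<nu>) = n" using bij_betw_same_card[OF swap] card_\<mu> by simp
  interpret young_words n h ?\<nu>
  proof
    show "hessenberg n h" by fact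
    show "sum_list ?\<nu> = n" using card_\<nu> by (simp add: card_boxes)
    show "(r', c) \<in> boxes ?\<nu>" if "(r, c) \<in> boxes ?\<nu>" "r' \<le> r" for r c r'
      using that unfolding mem_boxes_conj_part[OF assms(2)] by (simp add: boxes_def)
  qed
  have Sig: "boxes \<mu> = (SIGMA i:{..<length \<mu>}. {..<\<mu> ! i})" by (auto simp: boxes_def)
  \<comment> \<open>The column of a box in \<mu>' is its row in \<mu>, and row i of \<mu>, counted
    from 0, contributes i once per box.\<close>
  have snd_sum: "(\<Sum>b\<in>boxes ?\<nu>. snd b) = n_stat \<mu>"
  proof -
    have "(\<Sum>b\<in>boxes ?\<nu>. snd b) = (\<Sum>b\<in>boxes \<mu>. fst b)"
      using sum.reindex_bij_betw[OF swap, of snd] by simp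
    also have "\<dots> = n_stat \<mu>"
      unfolding Sig n_stat_def using sum.Sigma[of "{..<length \<mu>}" "\<lambda>i. {..<\<mu> ! i}" "\<lambda>i c. i"]
      by (simp add: case_prod_beta' mult.commute)
    finally show ?thesis .
  qed
  \<comment> \<open>The first r rows of \<mu>' are the first r columns of \<mu>; their box count is
    the dimension of the kernel of the r-th power of the Jordan matrix.\<close>
  have min_sum: "card {b \<in> boxes ?\<nu>. fst b < r} = (\<Sum>m\<leftarrow>\<mu>. min r m)" for r
  proof -
    have "card {b \<in> boxes ?\<nu>. fst b < r} = card {b \<in> boxes \<mu>. snd b < r}"
      using card_filter_bij_betw[OF swap, of "\<lambda>b. fst b < r"] by simp
    also have "{b \<in> boxes \<mu>. snd b < r} = (SIGMA i:{..<length \<mu>}. {..<min r (\<mu> ! i)})"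
      by (auto simp: boxes_def)
    finally show ?thesis by (simp add: sum_list_sum_nth lessThan_atLeast0)
  qed
  \<comment> \<open>The top row of \<mu>' has one box per part of \<mu>, which leaves n minus the
    number of parts for the boxes with a box above them.\<close>
  have "card {b \<in> boxes ?\<nu>. fst b < 1} = length \<mu>"
  proof -
    have "min 1 m = 1" if "m \<in> set \<mu>" for m using assms(2) that by (force simp: is_partition_def)
    then have "map (min 1) \<mu> = map (\<lambda>_. 1) \<mu>" by simp
    then have "(\<Sum>m\<leftarrow>\<mu>. min 1 m) = (\<Sum>m\<leftarrow>\<mu>. 1)" by (rule arg_cong)
    then show ?thesis unfolding min_sum sum_list_triv by simp
  qed
  moreover have "boxes ?\<nu> = {b \<in> boxes ?\<nu>. fst b < 1} \<union> {b \<in> boxes ?\<nu>. 1 \<le> fst b}" by auto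
  then have "n = card {b \<in> boxes ?\<nu>. fst b < 1} + card {b \<in> boxes ?\<nu>. 1 \<le> fst b}"
    using card_Un_disjoint[of "{b \<in> boxes ?\<nu>. fst b < 1}" "{b \<in> boxes ?\<nu>. 1 \<le> fst b}"] card_\<nu>
    by (simp add: disjoint_iff)
  ultimately have card_B: "card {b \<in> boxes ?\<nu>. 1 \<le> coleg ?\<nu> b} = n - length \<mu>"
      and le: "length \<mu> \<le> n"
    unfolding boxes_coleg by simp_all
  let ?S = "{w \<in> col_families n :: (nat \<Rightarrow> nat \<Rightarrow> 'a) set.
    \<forall>r. card (ker_flag w n r) = CARD('a) ^ card {b \<in> boxes ?\<nu>. fst b < r}}"
  have "card {A \<in> ad_nilp_ideal n h :: 'a mat set.
      \<forall>r. card (ker_flag (mat_columns n A) n r) = CARD('a) ^ card {b \<in> boxes ?\<nu>. fst b < r}} = card ?S"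
    by (rule card_filter_bij_betw[OF bij_betw_mat_columns[OF assms(1)], symmetric])
  moreover have "A \<in> nilp_class \<mu> \<longleftrightarrow>
      (\<forall>r. card (ker_flag (mat_columns n A) n r) = CARD('a) ^ card {b \<in> boxes ?\<nu>. fst b < r})"
    if A: "A \<in> ad_nilp_ideal n h" for A :: "'a mat"
  proof -
    have carr: "A \<in> carrier_mat n n" using A by (simp add: ad_nilp_ideal_def)
    \<comment> \<open>From j \<le> i \<le> h i, after the shift to indices from 1: the matrices of
      the ideal are strictly upper triangular, so \<open>mem_nilp_class_iff\<close> applies.\<close>
    have "A $$ (i, j) = 0" if "j \<le> i" "i < n" for i j
    proof -
      have "Suc i \<in> {1..n}" "Suc j \<in> {1..n}" using that by auto
      moreover from this have "Suc j \<le> h (Suc i)"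
        using assms(1) that unfolding hessenberg_def by (meson Suc_le_mono order_trans)
      ultimately have "A $$ (Suc i - 1, Suc j - 1) = 0" using A unfolding ad_nilp_ideal_def by blast
      then show ?thesis by simp
    qed
    then show ?thesis
      using mem_nilp_class_iff[OF carr, of \<mu>] assms(2) card_mat_kernel_pow[OF assms(1) A]
      by (simp add: min_sum is_partition_def)
  qed
  then have "nilp_class \<mu> \<inter> ad_nilp_ideal n h = {A \<in> ad_nilp_ideal n h :: 'a mat set.
      \<forall>r. card (ker_flag (mat_columns n A) n r) = CARD('a) ^ card {b \<in> boxes ?\<nu>. fst b < r}}"
    by blast
  ultimately have "real (F_count TYPE('a) n \<mu> h) = real (card ?S)" by (simp add: F_count_def)
  also have "\<dots> = (\<Sum>\<rho>\<in>words. \<Prod>i<n. step_factor (real q) \<rho> i)"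
    unfolding assms(3) by (rule card_class_families)
  also have "\<dots> = real q powi (int (n choose 2) - int (n_stat \<mu>) - int (n - length \<mu>)) *
      (real q - 1) ^ (n - length \<mu>) * F_under ?\<nu> h (1 / real q)"
    using sum_prod_step_factor[of "real q"] card_field_gt_1[where 'a = 'a]
    unfolding snd_sum card_B assms(3) by simp
  \<comment> \<open>Since there are at most n parts, the natural subtraction in the exponent is not
    truncated.\<close>
  finally show ?thesis using le by (simp add: of_nat_diff)
qed

end
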